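(* Suppose that the Conforti–Cornuéjols conjecture is true, i.e. suppose that every simple hypergraph with the packing property has the max-flow min-cut (MFMC) property. Let $k$ be a field and let $I$ be any square-free monomial ideal in $R = k[x_1,\dots,x_d]$. If $I^n = I^{(n)}$ for all $1 \le n \le N = \lceil \frac{d+1}{2} \rceil$, then $I^n = I^{(n)}$ for all $n \ge 1$.
   Context: The $n$-th symbolic power $I^{(n)}$ is the intersection of the primary components of $I^n$ that correspond to the minimal primes of $I$. A simple hypergraph $\mathcal H$ (clutter) on a finite vertex set $\{x_1,\dots,x_m\}$ is a family $E(\mathcal H)$ of nonempty subsets (edges) with no non-trivial containments. Minors: the deletion of a vertex $x$ removes $x$ from the vertex set and deletes all edges containing $x$; the contraction of $x$ removes $x$ from the vertex set and from all edges containing it, keeping only the inclusion-minimal resulting sets. A minor is obtained by a sequence of deletions and contractions. Packing property: $\alpha_0(\mathcal H)$ is the minimum cardinality of a vertex cover (a set of vertices meeting every edge), and $\beta_1(\mathcal H)$ is the maximum number of pairwise disjoint edges. $\mathcal H$ satisfies the König property if $\alpha_0(\mathcal H) = \beta_1(\mathcal H)$, and has the packing property if $\mathcal H$ and all its minors satisfy the König property. (Trivial minors, with no edges or with the empty set as an edge, are regarded as satisfying the König property.) MFMC property: let $A$ be the $m \times q$ incidence matrix whose columns are the $0/1$ characteristic vectors of the $q$ edges. $\mathcal H$ has the MFMC property if for every nonnegative integral vector $c \in \mathbb Z_{\ge 0}^m$ both sides of the linear programming duality $$\min\{\langle c, x\rangle \mid x\in\mathbb R^m,\ x \ge 0,\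 xA \ge \mathbf 1\} = \max\{\langle y, \mathbf 1\rangle \mid y \in\mathbb R^q,\ y \ge 0,\ Ay \le c\}$$ have integral optimal solutions $x$ and $y$. *)

theory Defs
  imports
    "HOL-Algebra.Ideal_Product"
    "HOL-Algebra.Algebraic_Closure_Type"
    "HOL-Library.Poly_Mapping"
begin

section \<open>Primary decomposition and symbolic powers\<close>

definition ideal_radical :: "('a, 'b) ring_scheme \<Rightarrow> 'a set \<Rightarrow> 'a set" where
  "ideal_radical R J = {a \<in> carrier R. \<exists>n::nat. a [^]\<^bsub>R\<^esub> n \<in> J}"

definition primary_ideal :: "('a, 'b) ring_scheme \<Rightarrow> 'a set \<Rightarrow> bool" where
  "primary_ideal R Q \<longleftrightarrow> ideal Q R \<and> Q \<noteq> carrier R \<and>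
     (\<forall>a\<in>carrier R. \<forall>b\<in>carrier R.
        a \<otimes>\<^bsub>R\<^esub> b \<in> Q \<longrightarrow> a \<in> Q \<or> (\<exists>n::nat. b [^]\<^bsub>R\<^esub> n \<in> Q))"

definition minimal_primes :: "('a, 'b) ring_scheme \<Rightarrow> 'a set \<Rightarrow> 'a set set" where
  "minimal_primes R J = {P. primeideal P R \<and> J \<subseteq> P \<and>
     (\<forall>P'. primeideal P' R \<and> J \<subseteq> P' \<and> P' \<subseteq> P \<longrightarrow> P' = P)}"

text \<open>Minimal primary decompositions: the radicals are pairwise distinct and no component
  is redundant. The intersection with the carrier gives the empty family the value of the
  unit ideal.\<close>

definition minimal_primary_decomposition ::
    "('a, 'b) ring_scheme \<Rightarrow> 'a set set \<Rightarrow> 'a set \<Rightarrow> bool" where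
  "minimal_primary_decomposition R \<Q> J \<longleftrightarrow>
     finite \<Q> \<and> (\<forall>Q\<in>\<Q>. primary_ideal R Q) \<and> carrier R \<inter> \<Inter>\<Q> = J \<and>
     inj_on (ideal_radical R) \<Q> \<and>
     (\<forall>Q\<in>\<Q>. \<not> carrier R \<inter> \<Inter>(\<Q> - {Q}) \<subseteq> Q)"

definition ideal_power :: "('a, 'b) ring_scheme \<Rightarrow> 'a set \<Rightarrow> nat \<Rightarrow> 'a set" where
  "ideal_power R I n = I [^]\<^bsub>ideals_set R\<^esub> n"

text \<open>The component of a minimal primary decomposition whose radical is a minimal prime is
  the same for every such decomposition (in a Noetherian ring), so collecting the components
  over all decompositions adds nothing to those of a single one.\<close>

definition symbolic_power :: "('a, 'b) ring_scheme \<Rightarrow> 'a set \<Rightarrow> nat \<Rightarrow> 'a set" where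
  "symbolic_power R I n = carrier R \<inter>
     \<Inter>{Q. \<exists>\<Q>. minimal_primary_decomposition R \<Q> (ideal_power R I n) \<and> Q \<in> \<Q> \<and>
            ideal_radical R Q \<in> minimal_primes R I}"


section \<open>Square-free monomial ideals\<close>

text \<open>The polynomial ring over the field \<open>'k\<close> with variables indexed by the finite type
  \<open>'v\<close>: a polynomial maps exponent vectors to coefficients, with finite support.\<close>

abbreviation mpoly_ring :: "(('v::finite \<Rightarrow>\<^sub>0 nat) \<Rightarrow>\<^sub>0 'k::field) ring" where
  "mpoly_ring \<equiv> ring_of_type_algebra"

definition monomial :: "('v \<Rightarrow>\<^sub>0 nat) \<Rightarrow> (('v::finite \<Rightarrow>\<^sub>0 nat) \<Rightarrow>\<^sub>0 'k::field)" where
  "monomial a = Poly_Mapping.single a 1"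

definition squarefree_monomial_ideal :: "(('v::finite \<Rightarrow>\<^sub>0 nat) \<Rightarrow>\<^sub>0 'k::field) set \<Rightarrow> bool" where
  "squarefree_monomial_ideal I \<longleftrightarrow>
     (\<exists>S. (\<forall>a\<in>S. \<forall>i. Poly_Mapping.lookup a i \<le> 1) \<and> I = Idl\<^bsub>mpoly_ring\<^esub> (monomial ` S))"


section \<open>Simple hypergraphs, minors, and the packing property\<close>

definition simple_hypergraph :: "'v set \<Rightarrow> 'v set set \<Rightarrow> bool" where
  "simple_hypergraph V E \<longleftrightarrow> finite V \<and> E \<subseteq> Pow V \<and> {} \<notin> E \<and>
     (\<forall>e\<in>E. \<forall>f\<in>E. e \<subseteq> f \<longrightarrow> e = f)"

definition minimal_sets :: "'v set set \<Rightarrow> 'v set set" where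
  "minimal_sets F = {e \<in> F. \<forall>f\<in>F. f \<subseteq> e \<longrightarrow> f = e}"

definition delete_edges :: "'v \<Rightarrow> 'v set set \<Rightarrow> 'v set set" where
  "delete_edges x E = {e \<in> E. x \<notin> e}"

definition contract_edges :: "'v \<Rightarrow> 'v set set \<Rightarrow> 'v set set" where
  "contract_edges x E = minimal_sets ((\<lambda>e. e - {x}) ` E)"

inductive hypergraph_minor :: "'v set \<Rightarrow> 'v set set \<Rightarrow> 'v set \<Rightarrow> 'v set set \<Rightarrow> bool"
  for V :: "'v set" and E :: "'v set set" where
  refl: "hypergraph_minor V E V E"
| deletion: "\<lbrakk>hypergraph_minor V E V' E'; x \<in> V'\<rbrakk>
    \<Longrightarrow> hypergraph_minor V E (V' - {x}) (delete_edges x E')"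
| contraction: "\<lbrakk>hypergraph_minor V E V' E'; x \<in> V'\<rbrakk>
    \<Longrightarrow> hypergraph_minor V E (V' - {x}) (contract_edges x E')"

definition vertex_covers :: "'v set \<Rightarrow> 'v set set \<Rightarrow> 'v set set" where
  "vertex_covers V E = {C. C \<subseteq> V \<and> (\<forall>e\<in>E. C \<inter> e \<noteq> {})}"

definition matchings :: "'v set set \<Rightarrow> 'v set set set" where
  "matchings E = {M. M \<subseteq> E \<and> pairwise disjnt M}"

definition alpha0 :: "'v set \<Rightarrow> 'v set set \<Rightarrow> nat" where
  "alpha0 V E = Min (card ` vertex_covers V E)"

definition beta1 :: "'v set set \<Rightarrow> nat" where
  "beta1 E = Max (card ` matchings E)"

text \<open>If the empty set is an edge there is no vertex cover and \<open>alpha0\<close> is not meaningful; such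
  hypergraphs have the Koenig property by convention.\<close>

definition koenig_property :: "'v set \<Rightarrow> 'v set set \<Rightarrow> bool" where
  "koenig_property V E \<longleftrightarrow> E = {} \<or> {} \<in> E \<or> alpha0 V E = beta1 E"

definition packing_property :: "'v set \<Rightarrow> 'v set set \<Rightarrow> bool" where
  "packing_property V E \<longleftrightarrow>
     (\<forall>V' E'. hypergraph_minor V E V' E' \<longrightarrow> koenig_property V' E')"


section \<open>The max-flow min-cut property\<close>

definition incidence :: "'v \<Rightarrow> 'v set \<Rightarrow> real" where
  "incidence v e = (if v \<in> e then 1 else 0)"

text \<open>Vectors indexed by \<open>V\<close> and by \<open>E\<close> are functions of which only the values on \<open>V\<close>
  and on \<open>E\<close> matter.\<close>

definition covering_feasible :: "'v set \<Rightarrow> 'v set set \<Rightarrow> ('v \<Rightarrow> real) \<Rightarrow> bool" where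
  "covering_feasible V E x \<longleftrightarrow> (\<forall>v\<in>V. x v \<ge> 0) \<and>
     (\<forall>e\<in>E. (\<Sum>v\<in>V. x v * incidence v e) \<ge> 1)"

definition packing_feasible ::
    "'v set \<Rightarrow> 'v set set \<Rightarrow> ('v \<Rightarrow> nat) \<Rightarrow> ('v set \<Rightarrow> real) \<Rightarrow> bool" where
  "packing_feasible V E c y \<longleftrightarrow> (\<forall>e\<in>E. y e \<ge> 0) \<and>
     (\<forall>v\<in>V. (\<Sum>e\<in>E. incidence v e * y e) \<le> real (c v))"

definition mfmc_property :: "'v set \<Rightarrow> 'v set set \<Rightarrow> bool" where
  "mfmc_property V E \<longleftrightarrow> (\<forall>c :: 'v \<Rightarrow> nat.
     (\<exists>x. is_arg_min (\<lambda>x. \<Sum>v\<in>V. real (c v) * x v) (covering_feasible V E) x \<and>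
          (\<forall>v\<in>V. x v \<in> \<int>)) \<and>
     (\<exists>y. is_arg_max (\<lambda>y. \<Sum>e\<in>E. y e) (packing_feasible V E c) y \<and>
          (\<forall>e\<in>E. y e \<in> \<int>)))"

end

(*
  Both sides are monomial ideals. A monomial x^a lies in I^n iff a dominates a sum of n edges of
  the hypergraph H of I, and for n >= 1 the equality I^n = I^(n) says that this holds for every a
  whose sum over each vertex cover of H is at least n ("cover packing of order n"). Cover packing
  passes to minors. Up to order (d+1)/2 rounded up it forces the Koenig property: test it with
  a = (1,...,1); a matching of that size would need more than d vertices unless an edge is a single
  vertex. So H has the packing property, hence by hypothesis max-flow min-cut, and LP duality
  returns cover packing of every order.
*)

theory Submission
  imports Defs "HOL-Analysis.Polytope"
begin

section \<open>Cover packings, minors and the Koenig property\<close>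

text \<open>The obstacle on the ring side is that \<open>symbolic_power\<close> ranges over
  components of minimal primary decompositions of \<open>I^n\<close>, which are hard to exhibit for
  an arbitrary power. The two halves of the translation get around this differently. A monomial that
  satisfies the cover inequalities lies in every component over a minimal prime, whichever
  decomposition it comes from: some monomial in the variables outside that prime multiplies it into
  \<open>I^n\<close>. Conversely, once cover packing of order n holds, \<open>I^n\<close> is the
  intersection of the n-th powers of its minimal primes, and this intersection is itself a minimal
  primary decomposition. The bound n <= ceiling((d+1)/2) is used in the equivalent form 2 n <= d +
  2. Its last order is floor(d/2) + 1, one more than the size of any matching whose edges all have
  at least two vertices. That extra order rules out a covering number above floor(d/2). The bound
  depends on the number of vertices only and grows with it, so it is inherited by minors.\<close>

definition edge_packable :: "'v set \<Rightarrow> 'v set set \<Rightarrow> nat \<Rightarrow> ('v \<Rightarrow> nat) \<Rightarrow> bool" where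
  "edge_packable V E n a \<longleftrightarrow>
     (\<exists>y. n \<le> sum y E \<and> (\<forall>v\<in>V. (\<Sum>e\<in>{e\<in>E. v \<in> e}. y e) \<le> a v))"

text \<open>Integral duality at the value \<open>n\<close>: the hypothesis bounds the 0/1 points of
  the covering program with weights \<open>a\<close>, the conclusion is an integral packing with
  capacities \<open>a\<close>. The converse implication is weak duality, proved for the full vertex
  set in \<open>cover_degree_packable\<close>.\<close>

definition cover_packing :: "'v set \<Rightarrow> 'v set set \<Rightarrow> nat \<Rightarrow> bool" where
  "cover_packing V E n \<longleftrightarrow>
     (\<forall>a. (\<forall>C\<in>vertex_covers V E. n \<le> sum a C) \<longrightarrow> edge_packable V E n a)"

text \<open>Push the multiplicities forward along \<open>g\<close>, adding them up over each fibre.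
  Image edges through \<open>v\<close> come only from edges through \<open>k v\<close>, so the load
  on \<open>v\<close> is at most the load on \<open>k v\<close>. Contraction uses this with
  \<open>k\<close> the identity, relabelling with \<open>k\<close> the inverse of an
  injection.\<close>

lemma edge_packable_map:
  assumes "edge_packable V E n a" "finite E" "finite E'" "g ` E \<subseteq> E'"
    and k: "\<And>v. v \<in> V' \<Longrightarrow> k v \<in> V \<and> a (k v) \<le> a' v"
    and g: "\<And>v e. v \<in> V' \<Longrightarrow> e \<in> E \<Longrightarrow> v \<in> g e \<Longrightarrow> k v \<in> e"
  shows "edge_packable V' E' n a'"
proof -
  obtain y where y: "n \<le> sum y E" "\<And>v. v \<in> V \<Longrightarrow> (\<Sum>e\<in>{e\<in>E. v \<in> e}. y e) \<le> a v"
    using assms(1) unfolding edge_packable_def by blast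
  define y' where "y' f = (\<Sum>e\<in>{e\<in>E. g e = f}. y e)" for f
  have "n \<le> sum y' E'"
    unfolding y'_def using sum.group[OF assms(2-4), of y] y(1) by simp
  moreover have "(\<Sum>f\<in>{f\<in>E'. v \<in> f}. y' f) \<le> a' v" if v: "v \<in> V'" for v
  proof -
    have "(\<Sum>f\<in>{f\<in>E'. v \<in> f}. y' f)
        = (\<Sum>f\<in>{f\<in>E'. v \<in> f}. sum y {e\<in>{e\<in>E. v \<in> g e}. g e = f})"
      unfolding y'_def by (intro sum.cong arg_cong2[where f = sum] refl) auto
    also have "\<dots> = sum y {e\<in>E. v \<in> g e}"
      using assms(2-4) by (intro sum.group) auto
    also have "\<dots> \<le> sum y {e\<in>E. k v \<in> e}"
      using assms(2) g[OF v] by (intro sum_mono2) auto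
    also have "\<dots> \<le> a' v" using y(2) k[OF v] le_trans by blast
    finally show ?thesis .
  qed
  ultimately show ?thesis unfolding edge_packable_def by blast
qed

lemma exists_minimal_subset:
  assumes "finite F" "e \<in> F"
  shows "\<exists>f\<in>minimal_sets F. f \<subseteq> e"
proof -
  obtain f where "f \<in> F" "f \<subseteq> e" "\<forall>g\<in>F. g \<subseteq> f \<longrightarrow> f = g"
    using finite_has_minimal2[OF assms] by blast
  then show ?thesis unfolding minimal_sets_def by blast
qed

lemma minimal_sets_subset: "minimal_sets F \<subseteq> F"
  unfolding minimal_sets_def by blast

text \<open>Capacity 0 at \<open>x\<close> forces every packing of \<open>E\<close> to use only
  edges that avoid \<open>x\<close>. Covers stay heavy enough, because a cover of \<open>E\<close>
  still covers those edges after losing \<open>x\<close>.\<close>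

lemma cover_packing_delete:
  assumes "finite V" "E \<subseteq> Pow V" "cover_packing V E n"
  shows "cover_packing (V - {x}) (delete_edges x E) n"
  unfolding cover_packing_def
proof (intro allI impI)
  fix a :: "'a \<Rightarrow> nat"
  assume a: "\<forall>C\<in>vertex_covers (V - {x}) (delete_edges x E). n \<le> sum a C"
  have finE: "finite E" using assms(1,2) finite_subset by blast
  have "n \<le> sum (a(x := 0)) C" if "C \<in> vertex_covers V E" for C
  proof -
    have "C - {x} \<in> vertex_covers (V - {x}) (delete_edges x E)"
      using that unfolding vertex_covers_def delete_edges_def by fastforce
    then have "n \<le> sum a (C - {x})" using a by blast
    also have "\<dots> = sum (a(x := 0)) (C - {x})" by (intro sum.cong) auto
    also have "\<dots> \<le> sum (a(x := 0)) C"
      using that assms(1) finite_subset unfolding vertex_covers_def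
      by (intro sum_mono2) auto
    finally show ?thesis .
  qed
  then obtain y where y: "n \<le> sum y E"
      "\<And>v. v \<in> V \<Longrightarrow> (\<Sum>e\<in>{e\<in>E. v \<in> e}. y e) \<le> (a(x := 0)) v"
    using assms(3) unfolding cover_packing_def edge_packable_def by blast
  have y0: "y e = 0" if "e \<in> E" "x \<in> e" for e
  proof -
    have "x \<in> V" using that assms(2) by blast
    then show ?thesis using y(2)[of x] that finE by simp
  qed
  have "sum y (delete_edges x E) = sum y E"
    unfolding delete_edges_def using y0 finE by (intro sum.mono_neutral_left) auto
  moreover have "(\<Sum>e\<in>{e\<in>delete_edges x E. v \<in> e}. y e) \<le> a v" if "v \<in> V - {x}" for v
  proof -
    have "(\<Sum>e\<in>{e\<in>delete_edges x E. v \<in> e}. y e) \<le> (\<Sum>e\<in>{e\<in>E. v \<in> e}. y e)"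
      using finE unfolding delete_edges_def by (intro sum_mono2) auto
    also have "\<dots> \<le> a v" using y(2)[of v] that by auto
    finally show ?thesis .
  qed
  ultimately show "edge_packable (V - {x}) (delete_edges x E) n a"
    using y(1) unfolding edge_packable_def by metis
qed

text \<open>Dually to deletion, \<open>x\<close> gets capacity \<open>n\<close>: covers through
  \<open>x\<close> are then heavy enough by themselves, and covers that avoid \<open>x\<close> also
  cover the contraction. Each edge \<open>e\<close> of the resulting packing is replaced by a
  minimal edge inside \<open>e - {x}\<close>.\<close>

lemma cover_packing_contract:
  assumes "finite V" "E \<subseteq> Pow V" "cover_packing V E n"
  shows "cover_packing (V - {x}) (contract_edges x E) n"
  unfolding cover_packing_def
proof (intro allI impI)
  fix a :: "'a \<Rightarrow> nat"
  assume a: "\<forall>C\<in>vertex_covers (V - {x}) (contract_edges x E). n \<le> sum a C"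
  have finE: "finite E" using assms(1,2) finite_subset by blast
  have sub: "contract_edges x E \<subseteq> (\<lambda>e. e - {x}) ` E"
    unfolding contract_edges_def by (rule minimal_sets_subset)
  have "n \<le> sum (a(x := n)) C" if C: "C \<in> vertex_covers V E" for C
  proof (cases "x \<in> C")
    case True
    have "finite C" using C assms(1) finite_subset unfolding vertex_covers_def by blast
    then show ?thesis using True member_le_sum[of x C "a(x := n)"] by simp
  next
    case False
    have "C \<inter> f \<noteq> {}" if f: "f \<in> contract_edges x E" for f
    proof -
      obtain e where "e \<in> E" "f = e - {x}" using f sub by blast
      then show ?thesis using C False unfolding vertex_covers_def by blast
    qed
    then have "C \<in> vertex_covers (V - {x}) (contract_edges x E)"
      using C False unfolding vertex_covers_def by blast
    then have "n \<le> sum a C" using a by blast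
    also have "\<dots> = sum (a(x := n)) C" using False by (intro sum.cong) auto
    finally show ?thesis .
  qed
  then have pack: "edge_packable V E n (a(x := n))"
    using assms(3) unfolding cover_packing_def by blast
  have "\<forall>e\<in>E. \<exists>f\<in>contract_edges x E. f \<subseteq> e - {x}"
    using exists_minimal_subset[of "(\<lambda>e. e - {x}) ` E"] finE
    unfolding contract_edges_def by blast
  then obtain g where g: "\<And>e. e \<in> E \<Longrightarrow> g e \<in> contract_edges x E \<and> g e \<subseteq> e - {x}"
    by metis
  show "edge_packable (V - {x}) (contract_edges x E) n a"
    using g finite_subset[OF sub] finE
    by (intro edge_packable_map[OF pack, where g = g and k = "\<lambda>v. v"]) auto
qed

section \<open>Matchings, covers and the Koenig property of all minors\<close>

lemma card_matching_le_card_cover: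
  assumes "finite V" "C \<in> vertex_covers V E" "M \<in> matchings E"
  shows "card M \<le> card C"
proof -
  have fin: "finite C" using assms finite_subset unfolding vertex_covers_def by blast
  have M: "M \<subseteq> E" "pairwise disjnt M" using assms unfolding matchings_def by auto
  then have "\<forall>e\<in>M. \<exists>v. v \<in> C \<inter> e" using assms(2) unfolding vertex_covers_def by blast
  then obtain f where f: "\<And>e. e \<in> M \<Longrightarrow> f e \<in> C \<inter> e" by metis
  have "inj_on f M"
    using f M(2) unfolding inj_on_def pairwise_def disjnt_def by (metis IntD2 disjoint_iff)
  then show ?thesis using f fin by (intro card_inj_on_le[of f]) auto
qed

lemma koenig_propertyI:
  assumes "finite V" "E \<subseteq> Pow V" "C \<in> vertex_covers V E" "M \<in> matchings E" "card C = card M"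
  shows "koenig_property V E"
proof -
  have finE: "finite E" using assms(1,2) finite_subset by blast
  have fin: "finite (vertex_covers V E)" "finite (matchings E)"
    using finite_subset[of _ "Pow V"] finite_subset[of _ "Pow E"] assms(1) finE
    unfolding vertex_covers_def matchings_def by auto
  have "alpha0 V E = card C"
    unfolding alpha0_def
  proof (rule Min_eqI)
    show "card C \<le> n" if "n \<in> card ` vertex_covers V E" for n
      using that card_matching_le_card_cover[OF assms(1) _ assms(4)] assms(5) by auto
    show "card C \<in> card ` vertex_covers V E" using assms(3) by (rule imageI)
  qed (use fin in auto)
  moreover have "beta1 E = card M"
    unfolding beta1_def
  proof (rule Max_eqI)
    show "n \<le> card M" if "n \<in> card ` matchings E" for n
      using that card_matching_le_card_cover[OF assms(1,3)] assms(5) by auto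
    show "card M \<in> card ` matchings E" using assms(4) by (rule imageI)
  qed (use fin in auto)
  ultimately show ?thesis using assms(5) unfolding koenig_property_def by simp
qed

text \<open>Under unit capacities a vertex of an edge bounds its multiplicity by 1, and two used
  edges that meet would load a common vertex with 2. So the support of the packing is a
  matching.\<close>

lemma matching_of_packing:
  assumes "finite V" "E \<subseteq> Pow V" "{} \<notin> E" "edge_packable V E n (\<lambda>v. 1)"
  shows "\<exists>M\<in>matchings E. n \<le> card M"
proof -
  have finE: "finite E" using assms(1,2) finite_subset by blast
  obtain y where y: "n \<le> sum y E" "\<And>v. v \<in> V \<Longrightarrow> (\<Sum>e\<in>{e\<in>E. v \<in> e}. y e) \<le> 1"
    using assms(4) unfolding edge_packable_def by blast
  have le1: "y e \<le> 1" if e: "e \<in> E" for e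
  proof -
    obtain v where v: "v \<in> e" using e assms(3) by (metis ex_in_conv)
    have "y e \<le> (\<Sum>e\<in>{e\<in>E. v \<in> e}. y e)"
      using finE e v by (intro member_le_sum) auto
    then show ?thesis using y(2)[of v] v e assms(2) by fastforce
  qed
  define M where "M = {e\<in>E. y e = 1}"
  have "sum y E = sum y M"
    unfolding M_def
  proof (rule sum.mono_neutral_right[OF finE])
    show "\<forall>e\<in>E - {e\<in>E. y e = 1}. y e = 0" using le1 by (force simp: le_Suc_eq)
  qed blast
  then have "n \<le> card M" using y(1) unfolding M_def by simp
  moreover have "disjnt e f" if ef: "e \<in> M" "f \<in> M" "e \<noteq> f" for e f
  proof (rule ccontr)
    assume "\<not> disjnt e f"
    then obtain v where v: "v \<in> e" "v \<in> f" unfolding disjnt_def by blast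
    have "sum y {e, f} \<le> (\<Sum>e\<in>{e\<in>E. v \<in> e}. y e)"
      using finE ef v unfolding M_def by (intro sum_mono2) auto
    moreover have "sum y {e, f} = 2" using ef unfolding M_def by simp
    moreover have "v \<in> V" using v ef assms(2) unfolding M_def by blast
    ultimately show False using y(2)[of v] by simp
  qed
  ultimately show ?thesis unfolding matchings_def pairwise_def M_def by blast
qed

text \<open>An edge of one vertex is split off; if all edges have at least two vertices, no matching
  has more than half as many edges as there are vertices, so the assumption covers all orders
  up to the covering number.\<close>

lemma cover_packing_koenig:
  assumes "finite V" "E \<subseteq> Pow V" "{} \<notin> E"
    and "\<And>n. 2 * n \<le> card V + 2 \<Longrightarrow> cover_packing V E n"
  shows "\<exists>C\<in>vertex_covers V E. \<exists>M\<in>matchings E. card C = card M"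
  using assms
proof (induction "card V" arbitrary: V E rule: less_induct)
  case less
  show ?case
  proof (cases "\<exists>x. {x} \<in> E")
    case True
    then obtain x where x: "{x} \<in> E" by blast
    then have xV: "x \<in> V" using less.prems by blast
    define F where "F = delete_edges x E"
    have card: "card (V - {x}) < card V" using xV less.prems(1) by (intro psubset_card_mono) auto
    have "\<exists>C\<in>vertex_covers (V - {x}) F. \<exists>M\<in>matchings F. card C = card M"
      unfolding F_def
    proof (rule less.hyps[OF card])
      show "cover_packing (V - {x}) (delete_edges x E) n" if "2 * n \<le> card (V - {x}) + 2" for n
        using cover_packing_delete[OF less.prems(1,2) less.prems(4)] that card by simp
    qed (use less.prems in \<open>auto simp: delete_edges_def\<close>)
    then obtain C M where CM: "C \<in> vertex_covers (V - {x}) F" "M \<in> matchings F" "card C = card M"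
      by blast
    have "C \<subseteq> V" "M \<subseteq> Pow V"
      using CM(1,2) less.prems(2)
      unfolding vertex_covers_def matchings_def F_def delete_edges_def by auto
    then have fin: "finite C" "finite M"
      using less.prems(1) finite_subset finite_Pow_iff by metis+
    have "insert x C \<in> vertex_covers V E"
      using CM(1) xV unfolding vertex_covers_def F_def delete_edges_def by blast
    moreover have "insert {x} M \<in> matchings E"
      using CM(2) x unfolding matchings_def F_def delete_edges_def
      by (auto simp: pairwise_insert disjnt_def)
    moreover have "card (insert x C) = card (insert {x} M)"
      using CM fin unfolding vertex_covers_def matchings_def F_def delete_edges_def
      by (subst (1 2) card_insert_disjoint) auto
    ultimately show ?thesis by blast
  next
    case False
    have "V \<inter> e = e" if "e \<in> E" for e using that less.prems(2) by blast
    then have "V \<in> vertex_covers V E" using less.prems(3) unfolding vertex_covers_def by auto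
    then obtain C where C: "C \<in> vertex_covers V E"
        "\<And>C'. C' \<in> vertex_covers V E \<Longrightarrow> card C \<le> card C'"
      using ex_has_least_nat[of "\<lambda>C. C \<in> vertex_covers V E" V card] by metis
    \<comment> \<open>The second argument is the largest order that the hypothesis reaches, and its
      double exceeds \<open>card V\<close>. Once \<open>2 * n <= card V\<close> is known, the
      minimum can only be \<open>card C\<close>.\<close>
    define n where "n = min (card C) ((card V + 2) div 2)"
    have "cover_packing V E n" by (rule less.prems(4)) (unfold n_def, linarith)
    moreover have "n \<le> sum (\<lambda>v. 1) C'" if "C' \<in> vertex_covers V E" for C'
      using C(2)[OF that] unfolding n_def by simp
    ultimately obtain M where M: "M \<in> matchings E" "n \<le> card M"
      using matching_of_packing[OF less.prems(1-3)] unfolding cover_packing_def by blast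
    have ME: "M \<subseteq> E" "pairwise disjnt M" using M(1) unfolding matchings_def by auto
    have two: "2 \<le> card e" if e: "e \<in> M" for e
    proof -
      have "e \<in> E" using e ME by blast
      moreover have "finite e" using calculation less.prems(1,2) by (auto intro: finite_subset)
      ultimately have "card e \<noteq> 0" "card e \<noteq> 1"
        using False less.prems(3) by (auto simp: card_1_singleton_iff)
      then show ?thesis by linarith
    qed
    have "2 * n \<le> card M * 2" using M(2) by simp
    also have "\<dots> \<le> sum card M" using sum_bounded_below[of M 2 card] two by simp
    also have "\<dots> = card (\<Union>M)"
      using ME less.prems(1,2) by (intro card_Union_disjoint[symmetric]) (auto intro: finite_subset)
    also have "\<dots> \<le> card V" using ME less.prems(1,2) by (intro card_mono) auto
    finally have "n = card C" unfolding n_def by linarith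
    then show ?thesis
      using C(1) M card_matching_le_card_cover[OF less.prems(1) C(1) M(1)] le_antisym by blast
  qed
qed

lemma packing_propertyI:
  assumes "finite V" "E \<subseteq> Pow V"
    and "\<And>n. 2 * n \<le> card V + 2 \<Longrightarrow> cover_packing V E n"
  shows "packing_property V E"
  unfolding packing_property_def
proof (intro allI impI)
  fix V' E'
  assume "hypergraph_minor V E V' E'"
  \<comment> \<open>The invariant keeps the orders bounded by the original \<open>V\<close>. As
    \<open>V'\<close> is no larger, they include all orders that \<open>cover_packing_koenig\<close>
    asks for on \<open>V'\<close>.\<close>
  then have "finite V' \<and> card V' \<le> card V \<and> E' \<subseteq> Pow V' \<and>
      (\<forall>n. 2 * n \<le> card V + 2 \<longrightarrow> cover_packing V' E' n)"
  proof (induction rule: hypergraph_minor.induct)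
    case refl
    then show ?case using assms by blast
  next
    case (deletion V' E' x)
    then show ?case
      using cover_packing_delete[of V' E'] card_Diff1_le[of V' x]
      by (auto simp: delete_edges_def intro: le_trans)
  next
    case (contraction V' E' x)
    have "contract_edges x E' \<subseteq> Pow (V' - {x})"
      using contraction minimal_sets_subset[of "(\<lambda>e. e - {x}) ` E'"]
      unfolding contract_edges_def by blast
    then show ?case
      using contraction cover_packing_contract[of V' E'] card_Diff1_le[of V' x]
      by (auto intro: le_trans)
  qed
  then have inv: "finite V'" "card V' \<le> card V" "E' \<subseteq> Pow V'"
      "\<And>n. 2 * n \<le> card V + 2 \<Longrightarrow> cover_packing V' E' n" by blast+
  show "koenig_property V' E'"
  proof (cases "{} \<in> E'")
    case True
    then show ?thesis unfolding koenig_property_def by blast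
  next
    case False
    then show ?thesis
      using cover_packing_koenig[OF inv(1,3) False] inv koenig_propertyI[OF inv(1,3)]
      by (meson le_trans add_le_mono1)
  qed
qed

section \<open>Linear programming duality and the max-flow min-cut property\<close>

text \<open>Farkas' lemma: either \<open>(c, t)\<close> lies in the cone of pairs (capacities,
  value) attained by packings, or a hyperplane separates it from a finitely generated subcone, and
  the normal vector, rescaled, is a cover of weight below \<open>t\<close>.\<close>

lemma covering_packing_alternative:
  fixes E :: "'v::finite set set" and c :: "'v \<Rightarrow> nat" and t :: real
  shows "(\<exists>y. packing_feasible UNIV E c y \<and> t \<le> sum y E) \<or>
    (\<exists>x. covering_feasible UNIV E x \<and> (\<Sum>v\<in>UNIV. real (c v) * x v) < t)"
proof (rule disjCI)
  assume no_cover: "\<not> (\<exists>x. covering_feasible UNIV E x \<and> (\<Sum>v\<in>UNIV. real (c v) * x v) < t)"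
  define S :: "((real ^ 'v) \<times> real) set" where
    "S = (\<lambda>e. (\<chi> v. incidence v e, 1)) ` E \<union> range (\<lambda>v. (axis v 1, 0)) \<union> {(0, - 1)}"
  define W :: "((real ^ 'v) \<times> real) set" where
    "W = {p. \<exists>y. (\<forall>e\<in>E. 0 \<le> y e) \<and> (\<forall>v. (\<Sum>e\<in>E. incidence v e * y e) \<le> fst p $ v) \<and>
           snd p \<le> sum y E}"
  have finS: "finite S" unfolding S_def by simp
  have "convex_cone W"
    unfolding convex_cone_iff
  proof (intro conjI ballI allI impI)
    show "0 \<in> W" unfolding W_def by (auto intro!: exI[of _ "\<lambda>e. 0"])
  next
    fix p q assume "p \<in> W" "q \<in> W"
    then obtain y z where
      y: "\<forall>e\<in>E. 0 \<le> y e" "\<forall>v. (\<Sum>e\<in>E. incidence v e * y e) \<le> fst p $ v" "snd p \<le> sum y E" and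
      z: "\<forall>e\<in>E. 0 \<le> z e" "\<forall>v. (\<Sum>e\<in>E. incidence v e * z e) \<le> fst q $ v" "snd q \<le> sum z E"
      unfolding W_def by blast
    then show "p + q \<in> W"
      unfolding W_def
      by (auto simp: sum.distrib distrib_left intro!: exI[of _ "\<lambda>e. y e + z e"] add_mono)
  next
    fix p and r :: real assume "p \<in> W" "0 \<le> r"
    then obtain y where
      y: "\<forall>e\<in>E. 0 \<le> y e" "\<forall>v. (\<Sum>e\<in>E. incidence v e * y e) \<le> fst p $ v" "snd p \<le> sum y E"
      unfolding W_def by blast
    have "(\<Sum>e\<in>E. incidence v e * (r * y e)) = r * (\<Sum>e\<in>E. incidence v e * y e)" for v
      by (simp add: sum_distrib_left mult.left_commute)
    then show "r *\<^sub>R p \<in> W"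
      using y \<open>0 \<le> r\<close> unfolding W_def
      by (auto simp: sum_distrib_left[symmetric] intro!: exI[of _ "\<lambda>e. r * y e"] mult_left_mono)
  qed
  moreover have "S \<subseteq> W"
  proof
    fix p assume "p \<in> S"
    then consider e where "e \<in> E" "p = (\<chi> v. incidence v e, 1)" | v where "p = (axis v 1, 0)"
      | "p = (0, - 1)"
      unfolding S_def by blast
    then show "p \<in> W"
    proof cases
      case 1
      then show ?thesis unfolding W_def
        by (auto simp: if_distrib cong: if_cong intro!: exI[of _ "\<lambda>f. if f = e then 1 else 0"])
    next
      case 2
      then show ?thesis unfolding W_def by (auto simp: axis_def intro!: exI[of _ "\<lambda>f. 0"])
    next
      case 3
      then show ?thesis unfolding W_def by (auto intro!: exI[of _ "\<lambda>f. 0"])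
    qed
  qed
  ultimately have hull: "convex_cone hull S \<subseteq> W" by (intro hull_minimal)
  define p :: "(real ^ 'v) \<times> real" where "p = (\<chi> v. real (c v), t)"
  have "p \<in> convex_cone hull S"
  proof (rule ccontr)
    assume "p \<notin> convex_cone hull S"
    then obtain u b where ub: "u \<bullet> p < b" "\<And>q. q \<in> convex_cone hull S \<Longrightarrow> b < u \<bullet> q"
      using separating_hyperplane_closed_point[OF convex_convex_cone_hull
          closed_convex_cone_hull[OF finS]] by blast
    have b: "b < 0" using ub(2)[OF convex_cone_hull_contains_0] by simp
    \<comment> \<open>If \<open>u\<close> were negative at a generator, a positive multiple of it
      would give the value \<open>b\<close> exactly, against strict separation.\<close>
    have pos: "0 \<le> u \<bullet> q" if "q \<in> S" for q
    proof (rule ccontr)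
      assume neg: "\<not> 0 \<le> u \<bullet> q"
      have "(b / (u \<bullet> q)) *\<^sub>R q \<in> convex_cone hull S"
        using neg b that by (intro convex_cone_hull_mul hull_inc) (auto simp: divide_nonpos_neg)
      from ub(2)[OF this] neg show False by simp
    qed
    obtain w s where u: "u = (w, s)" by (cases u)
    have w: "0 \<le> w $ v" for v
      using pos[of "(axis v 1, 0)"] unfolding S_def u by (simp add: inner_axis)
    have s: "s \<le> 0" using pos[of "(0, - 1)"] unfolding S_def u by simp
    have ws: "0 \<le> (\<Sum>v\<in>UNIV. w $ v * incidence v e) + s" if "e \<in> E" for e
      using pos[of "(\<chi> v. incidence v e, 1)"] that unfolding S_def u by (simp add: inner_vec_def)
    have wc: "(\<Sum>v\<in>UNIV. w $ v * real (c v)) + s * t < 0"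
      using ub(1) b unfolding u p_def by (simp add: inner_vec_def)
    \<comment> \<open>With \<open>s = 0\<close> the inequality \<open>wc\<close> would make a sum of
      nonnegative terms negative. Hence \<open>s\<close> is negative and dividing by
      \<open>- s\<close> normalises \<open>w\<close> to a cover.\<close>
    have "0 \<le> (\<Sum>v\<in>UNIV. w $ v * real (c v))" using w by (intro sum_nonneg) auto
    then have s0: "s < 0" using s wc by (cases "s = 0") auto
    define x where "x v = w $ v / (- s)" for v
    have "covering_feasible UNIV E x"
      unfolding covering_feasible_def
    proof (intro conjI ballI)
      show "0 \<le> x v" for v using w[of v] s0 unfolding x_def by (simp add: divide_nonneg_neg)
      show "1 \<le> (\<Sum>v\<in>UNIV. x v * incidence v e)" if "e \<in> E" for e
      proof -
        have "(\<Sum>v\<in>UNIV. x v * incidence v e) = (\<Sum>v\<in>UNIV. w $ v * incidence v e) / (- s)"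
          unfolding x_def sum_divide_distrib by (simp add: field_simps)
        moreover have "- s \<le> (\<Sum>v\<in>UNIV. w $ v * incidence v e)" using ws[OF that] by linarith
        ultimately show ?thesis using s0 by (simp add: neg_divide_le_eq)
      qed
    qed
    moreover have "(\<Sum>v\<in>UNIV. real (c v) * x v) = (\<Sum>v\<in>UNIV. w $ v * real (c v)) / (- s)"
      unfolding x_def sum_divide_distrib by (simp add: field_simps)
    moreover have "\<dots> < t" using wc s0 by (simp add: divide_less_eq mult.commute field_simps)
    ultimately show False using no_cover by metis
  qed
  then have "p \<in> W" using hull by blast
  then show "\<exists>y. packing_feasible UNIV E c y \<and> t \<le> sum y E"
    unfolding W_def p_def packing_feasible_def by auto
qed

section \<open>Relabelling of the linear programs, and integral optima\<close>

lemma covering_feasible_image: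
  assumes "inj h"
  shows "covering_feasible (h ` V) ((`) h ` E) x \<longleftrightarrow> covering_feasible V E (x \<circ> h)"
proof -
  have "(\<Sum>v\<in>h ` V. x v * incidence v (h ` e)) = (\<Sum>v\<in>V. x (h v) * incidence v e)" for e
    using assms inj_on_subset[OF assms subset_UNIV]
    by (subst sum.reindex) (auto simp: incidence_def inj_image_mem_iff intro!: sum.cong)
  then show ?thesis unfolding covering_feasible_def by simp
qed

lemma sum_image_edges:
  assumes "inj h"
  shows "sum f ((`) h ` E) = (\<Sum>e\<in>E. f (h ` e))"
  using assms by (subst sum.reindex) (auto simp: inj_on_def inj_image_eq_iff)

lemma packing_feasible_image:
  assumes "inj h"
  shows "packing_feasible (h ` V) ((`) h ` E) c y \<longleftrightarrow> packing_feasible V E (c \<circ> h) (\<lambda>e. y (h ` e))"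
  using assms unfolding packing_feasible_def
  by (simp add: sum_image_edges incidence_def inj_image_mem_iff)

text \<open>The integral optimal cover dominates a 0/1 cover, so by hypothesis the covering optimum
  is at least \<open>n\<close>. Duality carries this value to the real packings, and the integral
  optimal packing attains it.\<close>

lemma mfmc_imp_cover_packing:
  fixes h :: "'v::finite \<Rightarrow> 'w"
  assumes "inj h" "mfmc_property (range h) ((`) h ` E)"
  shows "cover_packing UNIV E n"
  unfolding cover_packing_def
proof (intro allI impI)
  fix a :: "'v \<Rightarrow> nat"
  assume a: "\<forall>C\<in>vertex_covers UNIV E. n \<le> sum a C"
  define c where "c v = a (inv_into UNIV h v)" for v
  have cv: "c (h v) = a v" for v unfolding c_def inv_f_f[OF assms(1)] ..
  then have ch: "c \<circ> h = a" by (simp add: fun_eq_iff)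
  have reindex: "(\<Sum>v\<in>range h. real (c v) * x v) = (\<Sum>v\<in>UNIV. real (a v) * x (h v))" for x
    using sum.reindex[OF assms(1), of "\<lambda>v. real (c v) * x v"] by (simp add: cv)
  note mfmc = assms(2)[unfolded mfmc_property_def, THEN spec[of _ c]]
  obtain x where
    x: "is_arg_min (\<lambda>x. \<Sum>v\<in>range h. real (c v) * x v)
          (covering_feasible (range h) ((`) h ` E)) x" "\<And>v. x (h v) \<in> \<int>"
    using mfmc[THEN conjunct1] by auto
  obtain y where
    y: "is_arg_max (\<lambda>y. \<Sum>e\<in>(`) h ` E. y e) (packing_feasible (range h) ((`) h ` E) c) y"
        "\<And>e. e \<in> E \<Longrightarrow> y (h ` e) \<in> \<int>"
    using mfmc[THEN conjunct2] by auto
  have xf: "covering_feasible UNIV E (x \<circ> h)"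
    using x(1) unfolding is_arg_min_def covering_feasible_image[OF assms(1)] by blast
  have yf: "packing_feasible UNIV E a (\<lambda>e. y (h ` e))"
    using y(1) unfolding is_arg_max_def packing_feasible_image[OF assms(1)] ch by blast
  have xmin: "(\<Sum>v\<in>UNIV. real (a v) * x (h v)) \<le> (\<Sum>v\<in>UNIV. real (a v) * z v)"
    if "covering_feasible UNIV E z" for z
  proof -
    have "z \<circ> inv_into UNIV h \<circ> h = z" using assms(1) by (simp add: fun_eq_iff)
    then have "covering_feasible (range h) ((`) h ` E) (z \<circ> inv_into UNIV h)"
      using that unfolding covering_feasible_image[OF assms(1)] by simp
    then have "\<not> (\<Sum>v\<in>range h. real (c v) * (z \<circ> inv_into UNIV h) v) < (\<Sum>v\<in>range h. real (c v) * x v)"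
      using x(1) unfolding is_arg_min_def by blast
    then show ?thesis unfolding reindex using assms(1) by simp
  qed
  have ymax: "(\<Sum>e\<in>E. z e) \<le> (\<Sum>e\<in>E. y (h ` e))" if "packing_feasible UNIV E a z" for z
  proof -
    have z: "inv_into UNIV h ` h ` e = e" for e using assms(1) by (simp add: image_comp)
    have "packing_feasible (range h) ((`) h ` E) c (\<lambda>e. z (inv_into UNIV h ` e))"
      using that unfolding packing_feasible_image[OF assms(1)] ch z .
    then have "\<not> (\<Sum>e\<in>(`) h ` E. y e) < (\<Sum>e\<in>(`) h ` E. z (inv_into UNIV h ` e))"
      using y(1) unfolding is_arg_max_def by blast
    then show ?thesis unfolding sum_image_edges[OF assms(1)] z by simp
  qed
  \<comment> \<open>Integrality makes \<open>x\<close> vanish off \<open>C\<close>, so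
    \<open>C\<close> meets every edge; and \<open>x\<close> is at least 1 on \<open>C\<close>, so
    the weight of \<open>C\<close> is at most the value of \<open>x\<close>.\<close>
  define C where "C = {v. 1 \<le> x (h v)}"
  have x0: "x (h v) = 0" if "v \<notin> C" for v
  proof -
    obtain k where k: "x (h v) = of_int k" using x(2) Ints_cases by metis
    have "0 \<le> x (h v)" using xf unfolding covering_feasible_def by simp
    then show ?thesis using k that unfolding C_def by auto
  qed
  have "C \<inter> e \<noteq> {}" if "e \<in> E" for e
  proof
    assume "C \<inter> e = {}"
    then have "(\<Sum>v\<in>UNIV. x (h v) * incidence v e) = 0"
      using x0 by (intro sum.neutral) (auto simp: incidence_def)
    then show False using xf that unfolding covering_feasible_def by force
  qed
  then have "n \<le> sum a C" using a unfolding vertex_covers_def by blast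
  then have "real n \<le> (\<Sum>v\<in>C. real (a v))" by (simp flip: of_nat_sum)
  also have "\<dots> \<le> (\<Sum>v\<in>C. real (a v) * x (h v))"
    unfolding C_def by (intro sum_mono) (simp add: mult_le_cancel_left1)
  also have "\<dots> \<le> (\<Sum>v\<in>UNIV. real (a v) * x (h v))"
    using xf unfolding covering_feasible_def by (intro sum_mono2) auto
  finally have "real n \<le> (\<Sum>v\<in>UNIV. real (a v) * x (h v))" .
  \<comment> \<open>No cover has weight below \<open>n\<close>, so the alternative with
    \<open>t = n\<close> yields a real packing of value \<open>n\<close>, and \<open>y\<close> does
    at least as well.\<close>
  then have "\<not> (\<Sum>v\<in>UNIV. real (a v) * z v) < real n" if "covering_feasible UNIV E z" for z
    using xmin[OF that] by linarith
  then obtain z where "packing_feasible UNIV E a z" "real n \<le> sum z E"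
    using covering_packing_alternative[of E a "real n"] by blast
  then have n: "real n \<le> (\<Sum>e\<in>E. y (h ` e))" using ymax by force
  define y' where "y' e = nat \<lfloor>y (h ` e)\<rfloor>" for e
  have y': "real (y' e) = y (h ` e)" if e: "e \<in> E" for e
  proof -
    have "0 \<le> y (h ` e)" using yf e unfolding packing_feasible_def by blast
    then show ?thesis using y(2)[OF e] unfolding y'_def by (auto elim: Ints_cases)
  qed
  have "real n \<le> real (sum y' E)" using n y' by simp
  then have "n \<le> sum y' E" by linarith
  moreover have "(\<Sum>e\<in>{e\<in>E. v \<in> e}. y' e) \<le> a v" for v
  proof -
    have "real (\<Sum>e\<in>{e\<in>E. v \<in> e}. y' e) = (\<Sum>e\<in>E. incidence v e * y (h ` e))"
      unfolding of_nat_sum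
      by (intro sum.mono_neutral_cong_left) (auto simp: y' incidence_def)
    also have "\<dots> \<le> real (a v)" using yf unfolding packing_feasible_def by blast
    finally show ?thesis by linarith
  qed
  ultimately show "edge_packable UNIV E n a" unfolding edge_packable_def by blast
qed

section \<open>Monomial ideals and their powers\<close>

type_synonym ('v, 'k) mpoly = "('v \<Rightarrow>\<^sub>0 nat) \<Rightarrow>\<^sub>0 'k"

lemma mpoly_ring_simps [simp]:
  "carrier mpoly_ring = UNIV"
  "f \<otimes>\<^bsub>mpoly_ring\<^esub> g = f * g"
  "f \<oplus>\<^bsub>mpoly_ring\<^esub> g = f + g"
  "\<one>\<^bsub>mpoly_ring\<^esub> = 1"
  "\<zero>\<^bsub>mpoly_ring\<^esub> = 0"
  by (simp_all add: ring_of_type_algebra_def)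

lemma cring_mpoly_ring: "cring (mpoly_ring :: ('v::finite, 'k::field) mpoly ring)"
  by (rule cring_from_type_algebra)

lemma ring_mpoly_ring: "ring (mpoly_ring :: ('v::finite, 'k::field) mpoly ring)"
  by (rule ring_from_type_algebra)

lemma mpoly_ring_pow [simp]:
  "f [^]\<^bsub>mpoly_ring\<^esub> (n::nat) = (f :: ('v::finite, 'k::field) mpoly) ^ n"
  by (induction n) (simp_all add: mult.commute)

lemma ideal_mpoly_ring_iff:
  fixes J :: "('v::finite, 'k::field) mpoly set"
  shows "ideal J mpoly_ring \<longleftrightarrow>
    0 \<in> J \<and> (\<forall>f\<in>J. \<forall>g\<in>J. f + g \<in> J) \<and> (\<forall>f\<in>J. \<forall>r. r * f \<in> J)"
proof
  assume J: "ideal J mpoly_ring"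
  interpret ideal J mpoly_ring by fact
  show "0 \<in> J \<and> (\<forall>f\<in>J. \<forall>g\<in>J. f + g \<in> J) \<and> (\<forall>f\<in>J. \<forall>r. r * f \<in> J)"
    using additive_subgroup.zero_closed[OF additive_subgroup_axioms]
      additive_subgroup.a_closed[OF additive_subgroup_axioms] I_l_closed by simp
next
  assume J: "0 \<in> J \<and> (\<forall>f\<in>J. \<forall>g\<in>J. f + g \<in> J) \<and> (\<forall>f\<in>J. \<forall>r. r * f \<in> J)"
  interpret R: ring "mpoly_ring :: ('v, 'k) mpoly ring" by (rule ring_mpoly_ring)
  show "ideal J mpoly_ring"
  proof (rule idealI[OF ring_mpoly_ring])
    show "subgroup J (add_monoid mpoly_ring)"
    proof (rule R.add.subgroupI)
      show "J \<noteq> {}" using J by blast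
      show "\<ominus>\<^bsub>mpoly_ring\<^esub> f \<in> J" if "f \<in> J" for f
      proof -
        have "\<ominus>\<^bsub>mpoly_ring\<^esub> f = (- 1) * f" by (rule R.minus_equality) simp_all
        then show ?thesis using J that by metis
      qed
    qed (use J in auto)
  qed (use J in \<open>auto simp: mult.commute\<close>)
qed

text \<open>Over the finite type \<open>'v\<close> every function has finite support, hence
  \<open>lookup_exponent\<close> holds without a side condition.\<close>

definition exponent :: "('v::finite \<Rightarrow> nat) \<Rightarrow> ('v \<Rightarrow>\<^sub>0 nat)" where
  "exponent a = Abs_poly_mapping a"

lemma lookup_exponent [simp]: "Poly_Mapping.lookup (exponent a) = a"
  unfolding exponent_def by simp

lemma exponent_decompose:
  fixes a b :: "'v::finite \<Rightarrow>\<^sub>0 nat"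
  assumes "\<And>v. Poly_Mapping.lookup b v \<le> Poly_Mapping.lookup a v"
  shows "a = b + (a - b)"
  using assms by (intro poly_mapping_eqI) (simp add: lookup_add lookup_minus)

lemma keys_monomial [simp]: "Poly_Mapping.keys (monomial a) = {a}"
  unfolding monomial_def by simp

lemma monomial_add: "monomial (a + b) = monomial a * monomial b"
  unfolding monomial_def by (simp add: mult_single)

lemma monomial_zero: "monomial 0 = 1"
  unfolding monomial_def by simp

text \<open>The linear span of the monomials with exponent in \<open>A\<close>. Membership depends
  on the support only, which turns statements about monomial ideals into statements about sets of
  exponents.\<close>

definition exponent_ideal :: "('v::finite \<Rightarrow>\<^sub>0 nat) set \<Rightarrow> ('v, 'k::field) mpoly set" where
  "exponent_ideal A = {f. Poly_Mapping.keys f \<subseteq> A}"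

definition upward_closed :: "('v \<Rightarrow>\<^sub>0 nat) set \<Rightarrow> bool" where
  "upward_closed A \<longleftrightarrow> (\<forall>a\<in>A. \<forall>b. a + b \<in> A)"

lemma monomial_in_exponent_ideal [simp]: "monomial a \<in> exponent_ideal A \<longleftrightarrow> a \<in> A"
  unfolding exponent_ideal_def by simp

lemma ideal_exponent_ideal:
  assumes "upward_closed A"
  shows "ideal (exponent_ideal A :: ('v::finite, 'k::field) mpoly set) mpoly_ring"
  unfolding ideal_mpoly_ring_iff
proof (intro conjI ballI allI)
  fix f g :: "('v, 'k) mpoly"
  assume "f \<in> exponent_ideal A" "g \<in> exponent_ideal A"
  then show "f + g \<in> exponent_ideal A"
    using keys_add[of f g] unfolding exponent_ideal_def by blast
next
  fix f r :: "('v, 'k) mpoly"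
  assume "f \<in> exponent_ideal A"
  then show "r * f \<in> exponent_ideal A"
    using assms keys_mult[of f r] unfolding exponent_ideal_def upward_closed_def mult.commute[of r]
    by blast
qed (simp add: exponent_ideal_def)

lemma poly_mapping_sum_terms:
  "f = (\<Sum>a\<in>Poly_Mapping.keys f. Poly_Mapping.single a (Poly_Mapping.lookup f a))"
proof (rule poly_mapping_eqI)
  fix b
  show "Poly_Mapping.lookup f b = Poly_Mapping.lookup
      (\<Sum>a\<in>Poly_Mapping.keys f. Poly_Mapping.single a (Poly_Mapping.lookup f a)) b"
    by (cases "b \<in> Poly_Mapping.keys f")
      (auto simp: lookup_sum lookup_single when_def in_keys_iff sum.delta)
qed

text \<open>A polynomial is the sum of its terms, and each term is a constant times a monomial.
  Inclusions of monomial ideals in arbitrary ideals are therefore tested on monomials.\<close>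

lemma exponent_ideal_subset:
  fixes J :: "('v::finite, 'k::field) mpoly set"
  assumes "ideal J mpoly_ring" "\<And>a. a \<in> A \<Longrightarrow> monomial a \<in> J"
  shows "exponent_ideal A \<subseteq> J"
proof
  have J: "0 \<in> J" "\<And>f g. f \<in> J \<Longrightarrow> g \<in> J \<Longrightarrow> f + g \<in> J" "\<And>f r. f \<in> J \<Longrightarrow> r * f \<in> J"
    using assms(1) unfolding ideal_mpoly_ring_iff by auto
  have sum: "sum h F \<in> J" if "finite F" "\<And>i. i \<in> F \<Longrightarrow> h i \<in> J"
    for h :: "('v \<Rightarrow>\<^sub>0 nat) \<Rightarrow> ('v, 'k) mpoly" and F
    using that by (induction F rule: finite_induct) (auto intro: J)
  fix f :: "('v, 'k) mpoly"
  assume f: "f \<in> exponent_ideal A"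
  have "Poly_Mapping.single a c \<in> J" if "a \<in> A" for a and c :: 'k
  proof -
    have "Poly_Mapping.single a c = Poly_Mapping.single 0 c * monomial a"
      unfolding monomial_def by (simp add: mult_single)
    then show ?thesis using J(3) assms(2)[OF that] by simp
  qed
  then have "(\<Sum>a\<in>Poly_Mapping.keys f. Poly_Mapping.single a (Poly_Mapping.lookup f a)) \<in> J"
    using f unfolding exponent_ideal_def by (intro sum) auto
  then show "f \<in> J" using poly_mapping_sum_terms[of f] by simp
qed

lemma genideal_monomials:
  "Idl\<^bsub>mpoly_ring\<^esub> (monomial ` S) =
     (exponent_ideal {s + b | s b. s \<in> S} :: ('v::finite, 'k::field) mpoly set)" (is "?L = ?R")
proof
  interpret R: ring "mpoly_ring :: ('v, 'k) mpoly ring" by (rule ring_mpoly_ring)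
  have "upward_closed {s + b | s b. s \<in> S}"
    unfolding upward_closed_def by (force simp: add.assoc)
  then have "ideal ?R mpoly_ring" by (rule ideal_exponent_ideal)
  moreover have "monomial ` S \<subseteq> ?R"
  proof (rule image_subsetI)
    fix s assume "s \<in> S"
    then have "s + 0 \<in> {s + b | s b. s \<in> S}" by blast
    then show "monomial s \<in> ?R" by simp
  qed
  ultimately show "?L \<subseteq> ?R" by (rule R.genideal_minimal)
  have ideal: "ideal ?L mpoly_ring" by (rule R.genideal_ideal) simp
  have "monomial s \<in> ?L" if "s \<in> S" for s
    using R.genideal_self[of "monomial ` S"] that by auto
  then have "monomial (s + b) \<in> ?L" if "s \<in> S" for s b
    using ideal that unfolding ideal_mpoly_ring_iff add.commute[of s b] monomial_add by blast
  then show "?R \<subseteq> ?L" using ideal by (intro exponent_ideal_subset) auto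
qed

lemma ideal_prod_exponent_ideal:
  assumes "upward_closed A" "upward_closed B"
  shows "ideal_prod mpoly_ring (exponent_ideal A) (exponent_ideal B) =
     (exponent_ideal {a + b | a b. a \<in> A \<and> b \<in> B} :: ('v::finite, 'k::field) mpoly set)"
    (is "?L = ?R")
proof
  interpret R: ring "mpoly_ring :: ('v, 'k) mpoly ring" by (rule ring_mpoly_ring)
  show "?L \<subseteq> ?R"
  proof
    fix f assume "f \<in> ?L"
    then show "f \<in> ?R"
    proof (induction rule: ideal_prod.induct)
      case (prod f g)
      then show ?case using keys_mult[of f g] unfolding exponent_ideal_def by fastforce
    next
      case (sum f g)
      then show ?case using keys_add[of f g] unfolding exponent_ideal_def by auto
    qed
  qed
  have "ideal ?L mpoly_ring"
    using assms by (intro R.ideal_prod_is_ideal ideal_exponent_ideal)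
  moreover have "monomial (a + b) \<in> ?L" if "a \<in> A" "b \<in> B" for a b
    using ideal_prod.prod[of "monomial a" "exponent_ideal A" "monomial b" "exponent_ideal B"
        "mpoly_ring :: ('v, 'k) mpoly ring"] that
    by (simp add: monomial_add)
  ultimately show "?R \<subseteq> ?L" by (intro exponent_ideal_subset) auto
qed

section \<open>Exponents of the powers of a square-free monomial ideal\<close>

lemma ideal_power_simps:
  "ideal_power R J 0 = carrier R"
  "ideal_power R J (Suc n) = ideal_prod R (ideal_power R J n) J"
  unfolding ideal_power_def by (simp_all add: ideals_set_def)

lemma edge_packable_mono:
  assumes "edge_packable V E n a" "\<And>v. v \<in> V \<Longrightarrow> a v \<le> b v"
  shows "edge_packable V E n b"
  using assms unfolding edge_packable_def by (meson le_trans)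

definition packable_exponents :: "'v set set \<Rightarrow> nat \<Rightarrow> ('v::finite \<Rightarrow>\<^sub>0 nat) set" where
  "packable_exponents E n = {a. edge_packable UNIV E n (Poly_Mapping.lookup a)}"

lemma upward_closed_packable: "upward_closed (packable_exponents E n)"
  unfolding upward_closed_def packable_exponents_def
  by (auto simp: lookup_add intro: edge_packable_mono)

lemma packable_exponents_0: "packable_exponents E 0 = UNIV"
  unfolding packable_exponents_def edge_packable_def by (auto intro: exI[of _ "\<lambda>e. 0"])

lemma packable_exponents_1:
  fixes E :: "'v::finite set set"
  shows "a \<in> packable_exponents E 1 \<longleftrightarrow> (\<exists>e\<in>E. \<forall>v\<in>e. 1 \<le> Poly_Mapping.lookup a v)"
proof
  assume "a \<in> packable_exponents E 1"
  then obtain y where y: "1 \<le> sum y E" "\<And>v. (\<Sum>e\<in>{e\<in>E. v \<in> e}. y e) \<le> Poly_Mapping.lookup a v"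
    unfolding packable_exponents_def edge_packable_def by auto
  then obtain e where e: "e \<in> E" "1 \<le> y e"
    by (metis One_nat_def Suc_leI gr0I not_one_le_zero sum.neutral)
  have "1 \<le> Poly_Mapping.lookup a v" if "v \<in> e" for v
  proof -
    have "y e \<le> (\<Sum>e\<in>{e\<in>E. v \<in> e}. y e)" using e that by (intro member_le_sum) auto
    then show ?thesis using e y(2)[of v] by linarith
  qed
  then show "\<exists>e\<in>E. \<forall>v\<in>e. 1 \<le> Poly_Mapping.lookup a v" using e by blast
next
  assume "\<exists>e\<in>E. \<forall>v\<in>e. 1 \<le> Poly_Mapping.lookup a v"
  then obtain e where e: "e \<in> E" "\<forall>v\<in>e. 1 \<le> Poly_Mapping.lookup a v" by blast
  define y where "y f = (if f = e then 1 else 0 :: nat)" for f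
  have "(\<Sum>f\<in>{f\<in>E. v \<in> f}. y f) \<le> Poly_Mapping.lookup a v" for v
    unfolding y_def using e by auto
  moreover have "1 \<le> sum y E" unfolding y_def using e by simp
  ultimately show "a \<in> packable_exponents E 1"
    unfolding packable_exponents_def edge_packable_def by blast
qed

text \<open>One copy of a used edge can be split off a packing, and packings can be added. This is
  the recursion of \<open>ideal_power\<close> at the level of exponents.\<close>

lemma packable_exponents_Suc:
  fixes E :: "'v::finite set set"
  shows "packable_exponents E (Suc n) =
    {a + b | a b. a \<in> packable_exponents E n \<and> b \<in> packable_exponents E 1}"
proof (intro equalityI subsetI)
  fix a assume "a \<in> packable_exponents E (Suc n)"
  then obtain y where y: "Suc n \<le> sum y E"
      "\<And>v. (\<Sum>e\<in>{e\<in>E. v \<in> e}. y e) \<le> Poly_Mapping.lookup a v"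
    unfolding packable_exponents_def edge_packable_def by auto
  then have "sum y E \<noteq> 0" by linarith
  then obtain e where e: "e \<in> E" "y e \<noteq> 0" using sum.neutral[of E y] by metis
  \<comment> \<open>The characteristic vector of \<open>e\<close>, that is, the load of the single
    copy that \<open>z\<close> gives up.\<close>
  define b where "b = exponent (\<lambda>v. if v \<in> e then 1 else 0)"
  define z where "z = y(e := y e - 1)"
  have split: "sum y F = sum z F + (if e \<in> F then 1 else 0)" for F
  proof (cases "e \<in> F")
    case True
    have "sum z (F - {e}) = sum y (F - {e})" unfolding z_def by (intro sum.cong) auto
    moreover have "sum y F = y e + sum y (F - {e})" "sum z F = z e + sum z (F - {e})"
      using True by (simp_all add: sum.remove)
    ultimately show ?thesis using e(2) True unfolding z_def by simp
  next
    case False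
    then show ?thesis unfolding z_def by (auto intro: sum.cong)
  qed
  have bound: "(\<Sum>f\<in>{f\<in>E. v \<in> f}. z f) + Poly_Mapping.lookup b v \<le> Poly_Mapping.lookup a v" for v
    using y(2)[of v] e(1) split[of "{f\<in>E. v \<in> f}"] unfolding b_def by (auto split: if_splits)
  then have "a = (a - b) + b"
    using exponent_decompose[of b a] by (metis add.commute add_leD2)
  moreover have "b \<in> packable_exponents E 1"
    using e unfolding packable_exponents_1 b_def by auto
  moreover have "a - b \<in> packable_exponents E n"
  proof -
    have "n \<le> sum z E" using y(1) split[of E] e by simp
    moreover have "(\<Sum>f\<in>{f\<in>E. v \<in> f}. z f) \<le> Poly_Mapping.lookup (a - b) v" for v
      using bound[of v] by (simp add: lookup_minus)
    ultimately show ?thesis unfolding packable_exponents_def edge_packable_def by blast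
  qed
  ultimately show "a \<in> {a + b | a b. a \<in> packable_exponents E n \<and> b \<in> packable_exponents E 1}"
    by blast
next
  fix c assume "c \<in> {a + b | a b. a \<in> packable_exponents E n \<and> b \<in> packable_exponents E 1}"
  then obtain a b y z where c: "c = a + b" and
    y: "n \<le> sum y E" "\<And>v. (\<Sum>e\<in>{e\<in>E. v \<in> e}. y e) \<le> Poly_Mapping.lookup a v" and
    z: "1 \<le> sum z E" "\<And>v. (\<Sum>e\<in>{e\<in>E. v \<in> e}. z e) \<le> Poly_Mapping.lookup b v"
    unfolding packable_exponents_def edge_packable_def by auto
  have "Suc n \<le> (\<Sum>e\<in>E. y e + z e)" using y(1) z(1) by (simp add: sum.distrib)
  moreover have "(\<Sum>e\<in>{e\<in>E. v \<in> e}. y e + z e) \<le> Poly_Mapping.lookup c v" for v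
    using y(2)[of v] z(2)[of v] unfolding c by (simp add: sum.distrib lookup_add add_mono)
  ultimately show "c \<in> packable_exponents E (Suc n)"
    unfolding packable_exponents_def edge_packable_def by blast
qed

text \<open>The edges are the inclusion-minimal supports of the generators. A square-free monomial
  is determined by its support, and divisibility between two of them is inclusion of
  supports.\<close>

lemma squarefree_ideal_powers:
  fixes I :: "('v::finite, 'k::field) mpoly set"
  assumes "squarefree_monomial_ideal I"
  obtains E :: "'v set set" where
    "\<And>e f. e \<in> E \<Longrightarrow> f \<in> E \<Longrightarrow> e \<subseteq> f \<Longrightarrow> e = f"
    "\<And>n. ideal_power mpoly_ring I n = exponent_ideal (packable_exponents E n)"
    "I = exponent_ideal (packable_exponents E 1)"
proof -
  obtain S where S: "\<And>a v. a \<in> S \<Longrightarrow> Poly_Mapping.lookup a v \<le> 1"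
      and I: "I = Idl\<^bsub>mpoly_ring\<^esub> (monomial ` S)"
    using assms unfolding squarefree_monomial_ideal_def by blast
  define E where "E = minimal_sets (Poly_Mapping.keys ` S)"
  have "{s + b | s b. s \<in> S} = packable_exponents E 1"
  proof (intro equalityI subsetI)
    fix a assume "a \<in> {s + b | s b. s \<in> S}"
    then obtain s b where s: "s \<in> S" "a = s + b" by blast
    obtain e where e: "e \<in> E" "e \<subseteq> Poly_Mapping.keys s"
      using exists_minimal_subset[OF finite imageI[OF s(1)]] unfolding E_def by metis
    have "1 \<le> Poly_Mapping.lookup a v" if "v \<in> e" for v
    proof -
      have "Poly_Mapping.lookup s v \<noteq> 0" using e(2) that unfolding in_keys_iff[symmetric] by blast
      then show ?thesis unfolding s(2) lookup_add by linarith
    qed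
    then show "a \<in> packable_exponents E 1" using e(1) unfolding packable_exponents_1 by metis
  next
    fix a assume "a \<in> packable_exponents E 1"
    then obtain e where "e \<in> E" and e: "\<forall>v\<in>e. 1 \<le> Poly_Mapping.lookup a v"
      unfolding packable_exponents_1 by blast
    then obtain s where s: "s \<in> S" "e = Poly_Mapping.keys s"
      unfolding E_def minimal_sets_def by blast
    \<comment> \<open>Square-freeness enters here: the exponents of \<open>s\<close> on its support
      \<open>e\<close> are at most 1, hence at most those of \<open>a\<close>.\<close>
    have "Poly_Mapping.lookup s v \<le> Poly_Mapping.lookup a v" for v
    proof (cases "v \<in> e")
      case True
      then show ?thesis using S[OF s(1), of v] e le_trans by blast
    next
      case False
      then show ?thesis unfolding s(2) in_keys_iff by simp
    qed
    then show "a \<in> {s + b | s b. s \<in> S}" using exponent_decompose[of s a] s(1) by blast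
  qed
  then have I1: "I = exponent_ideal (packable_exponents E 1)"
    unfolding I genideal_monomials by simp
  have "ideal_power mpoly_ring I n = exponent_ideal (packable_exponents E n)" for n
  proof (induction n)
    case 0
    then show ?case by (simp add: ideal_power_simps packable_exponents_0 exponent_ideal_def)
  next
    case (Suc n)
    then show ?case
      unfolding ideal_power_simps(2) Suc packable_exponents_Suc
      by (subst I1) (intro ideal_prod_exponent_ideal upward_closed_packable)
  qed
  then show ?thesis using I1 that[of E] unfolding E_def minimal_sets_def by blast
qed

section \<open>Powers of the prime ideals of vertex sets\<close>

text \<open>Since \<open>'v\<close> carries no linear order, there is no monomial order at hand; unique leading
  products are found by passing to successive faces, where one additive weight after the other
  is minimal.\<close>

definition sum_face :: "'a::plus set \<Rightarrow> 'a set \<Rightarrow> 'a set \<Rightarrow> 'a set \<Rightarrow> bool" where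
  "sum_face A B A' B' \<longleftrightarrow> A' \<subseteq> A \<and> B' \<subseteq> B \<and> A' \<noteq> {} \<and> B' \<noteq> {} \<and>
     (\<forall>a\<in>A'. \<forall>b\<in>B'. \<forall>a'\<in>A. \<forall>b'\<in>B. a + b = a' + b' \<longrightarrow> a' \<in> A' \<and> b' \<in> B')"

lemma sum_faceD:
  assumes "sum_face A B A' B'"
  shows "A' \<subseteq> A" "B' \<subseteq> B" "A' \<noteq> {}" "B' \<noteq> {}"
    "a \<in> A' \<Longrightarrow> b \<in> B' \<Longrightarrow> a' \<in> A \<Longrightarrow> b' \<in> B \<Longrightarrow> a + b = a' + b' \<Longrightarrow> a' \<in> A' \<and> b' \<in> B'"
  using assms unfolding sum_face_def by blast+

lemma sum_face_trans:
  assumes "sum_face A B A' B'" "sum_face A' B' A'' B''"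
  shows "sum_face A B A'' B''"
proof -
  have "a' \<in> A'' \<and> b' \<in> B''"
    if "a \<in> A''" "b \<in> B''" "a' \<in> A" "b' \<in> B" "a + b = a' + b'" for a b a' b'
  proof -
    have "a \<in> A'" "b \<in> B'" using that sum_faceD(1,2)[OF assms(2)] by blast+
    then have "a' \<in> A' \<and> b' \<in> B'" using sum_faceD(5)[OF assms(1)] that by blast
    then show ?thesis using sum_faceD(5)[OF assms(2) that(1,2) _ _ that(5)] by blast
  qed
  moreover have "A'' \<subseteq> A" "B'' \<subseteq> B"
    using sum_faceD(1,2)[OF assms(1)] sum_faceD(1,2)[OF assms(2)] by blast+
  ultimately show ?thesis using sum_faceD(3,4)[OF assms(2)] unfolding sum_face_def by metis
qed

text \<open>If \<open>a\<close> and \<open>b\<close> minimise an additive weight and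
  \<open>a + b = a' + b'\<close>, neither of \<open>a'\<close>, \<open>b'\<close> can be heavier,
  since the other would have to be lighter.\<close>

lemma sum_face_minimal:
  fixes \<phi> :: "'a::plus \<Rightarrow> nat"
  assumes "A \<noteq> {}" "B \<noteq> {}" and add: "\<And>a b. \<phi> (a + b) = \<phi> a + \<phi> b"
  shows "sum_face A B {a\<in>A. \<forall>a'\<in>A. \<phi> a \<le> \<phi> a'} {b\<in>B. \<forall>b'\<in>B. \<phi> b \<le> \<phi> b'}"
    (is "sum_face A B ?A ?B")
proof -
  have "{a\<in>F. \<forall>a'\<in>F. \<phi> a \<le> \<phi> a'} \<noteq> {}" if "F \<noteq> {}" for F
    using that ex_has_least_nat[of "\<lambda>a. a \<in> F" _ \<phi>] by blast
  then have ne: "?A \<noteq> {}" "?B \<noteq> {}" using assms by blast+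
  have "a' \<in> ?A \<and> b' \<in> ?B"
    if "a \<in> ?A" "b \<in> ?B" "a' \<in> A" "b' \<in> B" "a + b = a' + b'" for a b a' b'
  proof -
    have "\<phi> a + \<phi> b = \<phi> a' + \<phi> b'" using that(5) add by metis
    moreover have "\<phi> a \<le> \<phi> a'" "\<phi> b \<le> \<phi> b'" using that by auto
    ultimately have "\<phi> a = \<phi> a'" "\<phi> b = \<phi> b'" by linarith+
    then show ?thesis using that by auto
  qed
  then show ?thesis using ne unfolding sum_face_def by blast
qed

text \<open>Each coordinate is an additive weight; minimising one after the other makes the faces
  constant on \<open>U\<close>. For \<open>U = UNIV\<close> they shrink to single points.\<close>

lemma exists_sum_face_agreeing:
  fixes A B :: "('v \<Rightarrow>\<^sub>0 nat) set"
  assumes "finite U" "A \<noteq> {}" "B \<noteq> {}"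
  shows "\<exists>A' B'. sum_face A B A' B' \<and>
    (\<forall>a\<in>A'. \<forall>a'\<in>A'. \<forall>v\<in>U. Poly_Mapping.lookup a v = Poly_Mapping.lookup a' v) \<and>
    (\<forall>b\<in>B'. \<forall>b'\<in>B'. \<forall>v\<in>U. Poly_Mapping.lookup b v = Poly_Mapping.lookup b' v)"
  using assms(1)
proof (induction U rule: finite_induct)
  case empty
  show ?case using assms(2,3) by (intro exI[of _ A] exI[of _ B]) (auto simp: sum_face_def)
next
  case (insert u U)
  then obtain A1 B1 where 1: "sum_face A B A1 B1"
    "\<forall>a\<in>A1. \<forall>a'\<in>A1. \<forall>v\<in>U. Poly_Mapping.lookup a v = Poly_Mapping.lookup a' v"
    "\<forall>b\<in>B1. \<forall>b'\<in>B1. \<forall>v\<in>U. Poly_Mapping.lookup b v = Poly_Mapping.lookup b' v"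
    by blast
  define \<phi> :: "('v \<Rightarrow>\<^sub>0 nat) \<Rightarrow> nat" where "\<phi> a = Poly_Mapping.lookup a u" for a
  define A2 where "A2 = {a\<in>A1. \<forall>a'\<in>A1. \<phi> a \<le> \<phi> a'}"
  define B2 where "B2 = {b\<in>B1. \<forall>b'\<in>B1. \<phi> b \<le> \<phi> b'}"
  have "sum_face A1 B1 A2 B2"
    unfolding A2_def B2_def
    using 1(1) by (intro sum_face_minimal) (auto simp: sum_face_def \<phi>_def lookup_add)
  with 1(1) have face: "sum_face A B A2 B2" by (rule sum_face_trans)
  have A2: "Poly_Mapping.lookup a v = Poly_Mapping.lookup a' v"
    if "a \<in> A2" "a' \<in> A2" "v \<in> insert u U" for a a' v
  proof (cases "v = u")
    case True
    have "\<phi> a = \<phi> a'" using that(1,2) unfolding A2_def by (auto intro: le_antisym)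
    then show ?thesis unfolding \<phi>_def True .
  next
    case False
    then show ?thesis using that 1(2) unfolding A2_def by simp
  qed
  have B2: "Poly_Mapping.lookup b v = Poly_Mapping.lookup b' v"
    if "b \<in> B2" "b' \<in> B2" "v \<in> insert u U" for b b' v
  proof (cases "v = u")
    case True
    have "\<phi> b = \<phi> b'" using that(1,2) unfolding B2_def by (auto intro: le_antisym)
    then show ?thesis unfolding \<phi>_def True .
  next
    case False
    then show ?thesis using that 1(3) unfolding B2_def by simp
  qed
  show ?case
    by (intro exI[of _ A2] exI[of _ B2] conjI ballI face) (fact A2 B2)+
qed

text \<open>Minimise \<phi> first and then all coordinates. The resulting \<open>a + b\<close>
  arises from one pair of exponents only, so its coefficient in the product is a product of two
  nonzero field elements. Thus lowest weights add under multiplication.\<close>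

lemma keys_mult_minimal:
  fixes f g :: "('v::finite, 'k::field) mpoly" and \<phi> :: "('v \<Rightarrow>\<^sub>0 nat) \<Rightarrow> nat"
  assumes "f \<noteq> 0" "g \<noteq> 0" and "\<And>a b. \<phi> (a + b) = \<phi> a + \<phi> b"
  obtains a b where "a \<in> Poly_Mapping.keys f" "b \<in> Poly_Mapping.keys g"
    "a + b \<in> Poly_Mapping.keys (f * g)"
    "\<And>a'. a' \<in> Poly_Mapping.keys f \<Longrightarrow> \<phi> a \<le> \<phi> a'"
    "\<And>b'. b' \<in> Poly_Mapping.keys g \<Longrightarrow> \<phi> b \<le> \<phi> b'"
proof -
  define A where "A = Poly_Mapping.keys f"
  define B where "B = Poly_Mapping.keys g"
  define A1 where "A1 = {a\<in>A. \<forall>a'\<in>A. \<phi> a \<le> \<phi> a'}"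
  define B1 where "B1 = {b\<in>B. \<forall>b'\<in>B. \<phi> b \<le> \<phi> b'}"
  have "A \<noteq> {}" "B \<noteq> {}"
    using assms(1,2) unfolding A_def B_def by (auto simp: poly_mapping_eq_iff fun_eq_iff in_keys_iff)
  then have 1: "sum_face A B A1 B1"
    unfolding A1_def B1_def using assms(3) by (rule sum_face_minimal)
  then have "A1 \<noteq> {}" "B1 \<noteq> {}" by (rule sum_faceD)+
  then obtain A2 B2 where 2: "sum_face A1 B1 A2 B2"
    "\<forall>a\<in>A2. \<forall>a'\<in>A2. \<forall>v\<in>UNIV. Poly_Mapping.lookup a v = Poly_Mapping.lookup a' v"
    "\<forall>b\<in>B2. \<forall>b'\<in>B2. \<forall>v\<in>UNIV. Poly_Mapping.lookup b v = Poly_Mapping.lookup b' v"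
    using exists_sum_face_agreeing[of UNIV A1 B1] by auto
  have 3: "sum_face A B A2 B2" using sum_face_trans[OF 1 2(1)] .
  obtain a b where ab: "a \<in> A2" "b \<in> B2" using sum_faceD(3,4)[OF 3] by blast
  have eq: "a' = a" "b' = b" if "a' \<in> A" "b' \<in> B" "a + b = a' + b'" for a' b'
  proof -
    have "a' \<in> A2 \<and> b' \<in> B2" using sum_faceD(5)[OF 3 ab that] .
    then show "a' = a" "b' = b" using 2(2,3) ab by (blast intro: poly_mapping_eqI)+
  qed
  have abAB: "a \<in> A" "b \<in> B" using sum_faceD(1,2)[OF 3] ab by blast+
  \<comment> \<open>By uniqueness of the pair, \<open>l = a\<close> is the only index that
    contributes to the convolution at \<open>a + b\<close>.\<close>
  have "Poly_Mapping.lookup f l * (\<Sum>q. Poly_Mapping.lookup g q when a + b = l + q) =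
      (Poly_Mapping.lookup f a * Poly_Mapping.lookup g b when l = a)" for l
  proof (cases "l = a")
    case True
    then have "(\<lambda>q. Poly_Mapping.lookup g q when a + b = l + q) =
        (\<lambda>q. Poly_Mapping.lookup g q when b = q)" by auto
    then show ?thesis using True by simp
  next
    case False
    have "(Poly_Mapping.lookup g q when a + b = l + q) = 0" if "l \<in> A" for q
      using eq(1)[OF that, of q] False unfolding B_def by (auto simp: when_def in_keys_iff)
    then show ?thesis
      using False unfolding A_def by (cases "Poly_Mapping.lookup f l = 0") (simp_all add: in_keys_iff)
  qed
  then have "Poly_Mapping.lookup (f * g) (a + b) = Poly_Mapping.lookup f a * Poly_Mapping.lookup g b"
    unfolding lookup_mult by simp
  also have "\<dots> \<noteq> 0" using abAB unfolding A_def B_def by (simp add: in_keys_iff)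
  finally have "a + b \<in> Poly_Mapping.keys (f * g)" by (simp add: in_keys_iff)
  moreover have "a \<in> A1" "b \<in> B1" using sum_faceD(1,2)[OF 2(1)] ab by blast+
  ultimately show ?thesis
    using that abAB unfolding A1_def B1_def A_def B_def by blast
qed

text \<open>The order of vanishing of the monomial along the subspace where the variables in
  \<open>C\<close> are zero.\<close>

definition cover_degree :: "'v set \<Rightarrow> ('v::finite \<Rightarrow>\<^sub>0 nat) \<Rightarrow> nat" where
  "cover_degree C a = sum (Poly_Mapping.lookup a) C"

lemma cover_degree_add: "cover_degree C (a + b) = cover_degree C a + cover_degree C b"
  unfolding cover_degree_def by (simp add: lookup_add sum.distrib)

text \<open>The \<open>n\<close>-th power of the prime ideal generated by the variables in \<open>C\<close>.\<close>

definition cover_power :: "'v set \<Rightarrow> nat \<Rightarrow> ('v::finite, 'k::field) mpoly set" where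
  "cover_power C n = exponent_ideal {a. n \<le> cover_degree C a}"

lemma ideal_cover_power: "ideal (cover_power C n) mpoly_ring"
  unfolding cover_power_def
  by (rule ideal_exponent_ideal) (auto simp: upward_closed_def cover_degree_add)

lemma monomial_in_cover_power: "monomial a \<in> cover_power C n \<longleftrightarrow> n \<le> cover_degree C a"
  unfolding cover_power_def by simp

lemma one_notin_cover_power:
  assumes "1 \<le> n"
  shows "1 \<notin> cover_power C n"
proof -
  have "cover_degree C 0 = 0" unfolding cover_degree_def by simp
  then show ?thesis using monomial_in_cover_power[of 0 C n] assms unfolding monomial_zero by simp
qed

lemma cover_power_mult:
  assumes "f \<in> cover_power C m" "g \<in> cover_power C n"
  shows "f * g \<in> cover_power C (m + n)"
  unfolding cover_power_def exponent_ideal_def mem_Collect_eq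
proof
  fix c assume "c \<in> Poly_Mapping.keys (f * g)"
  then obtain a b where "a \<in> Poly_Mapping.keys f" "b \<in> Poly_Mapping.keys g" "c = a + b"
    using keys_mult[of f g] by blast
  then show "c \<in> {a. m + n \<le> cover_degree C a}"
    using assms unfolding cover_power_def exponent_ideal_def
    by (auto simp: cover_degree_add intro!: add_mono)
qed

lemma power_in_cover_power:
  assumes "f \<in> cover_power C 1"
  shows "f ^ n \<in> cover_power C n"
proof (induction n)
  case 0
  show ?case unfolding cover_power_def exponent_ideal_def by simp
next
  case (Suc n)
  then show ?case using cover_power_mult[OF assms Suc] by simp
qed

lemma cover_power_antimono: "m \<le> n \<Longrightarrow> cover_power C n \<subseteq> cover_power C m"
  unfolding cover_power_def exponent_ideal_def by auto

text \<open>The lowest \<open>C\<close>-degree of \<open>f * g\<close> is the sum of those of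
  \<open>f\<close> and \<open>g\<close>. If it is at least \<open>n\<close> while that of
  \<open>f\<close> is below \<open>n\<close>, every term of \<open>g\<close> has positive
  \<open>C\<close>-degree.\<close>

lemma cover_power_primary:
  fixes f g :: "('v::finite, 'k::field) mpoly"
  assumes "f * g \<in> cover_power C n" "f \<notin> cover_power C n"
  shows "g \<in> cover_power C 1"
proof (cases "g = 0")
  case True
  then show ?thesis unfolding cover_power_def exponent_ideal_def by simp
next
  case False
  have "f \<noteq> 0" using assms(2) unfolding cover_power_def exponent_ideal_def by auto
  then obtain a b where
    ab: "a \<in> Poly_Mapping.keys f" "b \<in> Poly_Mapping.keys g" "a + b \<in> Poly_Mapping.keys (f * g)"
    "\<And>a'. a' \<in> Poly_Mapping.keys f \<Longrightarrow> cover_degree C a \<le> cover_degree C a'"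
    "\<And>b'. b' \<in> Poly_Mapping.keys g \<Longrightarrow> cover_degree C b \<le> cover_degree C b'"
    by (rule keys_mult_minimal[where \<phi> = "cover_degree C", OF _ False cover_degree_add]) blast
  have "n \<le> cover_degree C a + cover_degree C b"
    using assms(1) ab(3) unfolding cover_power_def exponent_ideal_def
    by (auto simp: cover_degree_add)
  moreover have "cover_degree C a < n"
  proof -
    obtain a' where "a' \<in> Poly_Mapping.keys f" "\<not> n \<le> cover_degree C a'"
      using assms(2) unfolding cover_power_def exponent_ideal_def by auto
    then show ?thesis using ab(4)[of a'] by linarith
  qed
  ultimately have "1 \<le> cover_degree C b" by linarith
  then show ?thesis using ab(5) le_trans unfolding cover_power_def exponent_ideal_def by blast
qed

lemma primary_cover_power:
  assumes "1 \<le> n"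
  shows "primary_ideal mpoly_ring (cover_power C n :: ('v::finite, 'k::field) mpoly set)"
  unfolding primary_ideal_def mpoly_ring_simps mpoly_ring_pow
proof (intro conjI ballI impI)
  show "cover_power C n \<noteq> (UNIV :: ('v, 'k) mpoly set)"
    using one_notin_cover_power[OF assms] by auto
  show "f \<in> cover_power C n \<or> (\<exists>m. g ^ m \<in> cover_power C n)"
    if "f * g \<in> cover_power C n" for f g :: "('v, 'k) mpoly"
    using cover_power_primary[OF that] power_in_cover_power by blast
qed (rule ideal_cover_power)

lemma prime_cover_power:
  "primeideal (cover_power C 1 :: ('v::finite, 'k::field) mpoly set) mpoly_ring"
proof (rule primeidealI[OF ideal_cover_power cring_mpoly_ring])
  show "carrier mpoly_ring \<noteq> (cover_power C 1 :: ('v, 'k) mpoly set)"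
    using one_notin_cover_power[of 1 C] by auto
  show "f \<in> cover_power C 1 \<or> g \<in> cover_power C 1"
    if "f \<otimes>\<^bsub>mpoly_ring\<^esub> g \<in> cover_power C 1" for f g :: "('v, 'k) mpoly"
    using that cover_power_primary[of f g C 1] by auto
qed

lemma radical_cover_power:
  assumes "1 \<le> n"
  shows "ideal_radical mpoly_ring (cover_power C n) =
    (cover_power C 1 :: ('v::finite, 'k::field) mpoly set)"
proof (intro equalityI subsetI)
  fix f :: "('v, 'k) mpoly"
  assume "f \<in> ideal_radical mpoly_ring (cover_power C n)"
  then obtain m where m: "f ^ m \<in> cover_power C 1"
    using cover_power_antimono[OF assms, of C] unfolding ideal_radical_def by auto
  show "f \<in> cover_power C 1"
    using m
  proof (induction m)
    case 0
    then show ?case using one_notin_cover_power[OF order_refl] power_0 by metis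
  next
    case (Suc m)
    then show ?case using cover_power_primary[of "f ^ m" f C 1] by (auto simp: mult.commute)
  qed
next
  fix f :: "('v, 'k) mpoly"
  assume "f \<in> cover_power C 1"
  then show "f \<in> ideal_radical mpoly_ring (cover_power C n)"
    using power_in_cover_power[of f C n] unfolding ideal_radical_def by auto
qed

section \<open>Variables and monomials in prime ideals\<close>

definition variable :: "'v::finite \<Rightarrow> ('v, 'k::field) mpoly" where
  "variable v = monomial (Poly_Mapping.single v 1)"

lemma variable_in_cover_power: "variable v \<in> cover_power C 1 \<longleftrightarrow> v \<in> C"
proof -
  have "cover_degree C (Poly_Mapping.single v 1) = (if v \<in> C then 1 else 0)"
    unfolding cover_degree_def by (simp add: lookup_single when_def)
  then show ?thesis unfolding variable_def monomial_in_cover_power by simp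
qed

lemma monomial_split_variable:
  assumes "Poly_Mapping.lookup a v \<noteq> 0"
  shows "monomial a = variable v * monomial (a - Poly_Mapping.single v 1)"
proof -
  have "a = Poly_Mapping.single v 1 + (a - Poly_Mapping.single v 1)"
    using assms by (intro exponent_decompose) (auto simp: lookup_single when_def)
  then show ?thesis unfolding variable_def monomial_add[symmetric] by metis
qed

lemma cover_power_subset:
  assumes "ideal P mpoly_ring" "\<And>v. v \<in> C \<Longrightarrow> variable v \<in> P"
  shows "cover_power C 1 \<subseteq> P"
  unfolding cover_power_def
proof (rule exponent_ideal_subset[OF assms(1)])
  fix a assume "a \<in> {a. 1 \<le> cover_degree C a}"
  then have "1 \<le> sum (Poly_Mapping.lookup a) C" unfolding cover_degree_def by simp
  then obtain v where v: "v \<in> C" "Poly_Mapping.lookup a v \<noteq> 0"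
    using sum.neutral[of C "Poly_Mapping.lookup a"] by (metis not_one_le_zero)
  then show "monomial a \<in> P"
    using assms unfolding monomial_split_variable[OF v(2)] ideal_mpoly_ring_iff
    by (metis mult.commute)
qed

lemma prime_monomial:
  fixes P :: "('v::finite, 'k::field) mpoly set"
  assumes "primeideal P mpoly_ring" "monomial a \<in> P"
  shows "\<exists>v. Poly_Mapping.lookup a v \<noteq> 0 \<and> variable v \<in> P"
  using assms(2)
proof (induction "cover_degree UNIV a" arbitrary: a rule: less_induct)
  case less
  interpret P: primeideal P mpoly_ring by fact
  have "a \<noteq> 0"
  proof
    assume "a = 0"
    then have "1 \<in> P" using less.prems by (simp add: monomial_zero)
    then have "r \<in> P" for r using P.I_l_closed[of 1 r] by simp
    then show False using P.I_notcarr by auto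
  qed
  then obtain v where v: "Poly_Mapping.lookup a v \<noteq> 0"
    by (metis lookup_zero poly_mapping_eqI)
  define b where "b = a - Poly_Mapping.single v 1"
  have ab: "a = Poly_Mapping.single v 1 + b"
    unfolding b_def using v by (intro exponent_decompose) (auto simp: lookup_single when_def)
  have "variable v * monomial b \<in> P"
    using less.prems unfolding b_def monomial_split_variable[OF v] .
  then consider "variable v \<in> P" | "monomial b \<in> P"
    using P.I_prime[of "variable v" "monomial b"] by auto
  then show ?case
  proof cases
    case 1
    then show ?thesis using v by blast
  next
    case 2
    have "cover_degree UNIV a = Suc (cover_degree UNIV b)"
      unfolding ab cover_degree_add
      by (simp add: cover_degree_def lookup_single when_def)
    then obtain u where u: "Poly_Mapping.lookup b u \<noteq> 0 \<and> variable u \<in> P"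
      using less.hyps[OF _ 2] by auto
    then have "Poly_Mapping.lookup a u \<noteq> 0" unfolding ab lookup_add by simp
    then show ?thesis using u by blast
  qed
qed

text \<open>Weak duality: every edge meets \<open>C\<close>, so counting pairs of an edge and a
  vertex of \<open>C\<close> on it counts each edge at least once.\<close>

lemma cover_degree_packable:
  assumes "a \<in> packable_exponents E n" "C \<in> vertex_covers UNIV E"
  shows "n \<le> cover_degree C a"
proof -
  obtain y where y: "n \<le> sum y E" "\<And>v. (\<Sum>e\<in>{e\<in>E. v \<in> e}. y e) \<le> Poly_Mapping.lookup a v"
    using assms(1) unfolding packable_exponents_def edge_packable_def by auto
  have "sum y E \<le> (\<Sum>e\<in>E. \<Sum>v\<in>C. if v \<in> e then y e else 0)"
  proof (rule sum_mono)
    fix e assume "e \<in> E"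
    then obtain v where "v \<in> C" "v \<in> e" using assms(2) unfolding vertex_covers_def by blast
    then show "y e \<le> (\<Sum>v\<in>C. if v \<in> e then y e else 0)"
      using member_le_sum[of v C "\<lambda>v. if v \<in> e then y e else 0"] by simp
  qed
  also have "\<dots> = (\<Sum>v\<in>C. \<Sum>e\<in>E. if v \<in> e then y e else 0)" by (rule sum.swap)
  also have "\<dots> = (\<Sum>v\<in>C. \<Sum>e\<in>{e\<in>E. v \<in> e}. y e)" by (simp add: sum.inter_filter)
  also have "\<dots> \<le> cover_degree C a" unfolding cover_degree_def by (intro sum_mono y(2))
  finally show ?thesis using y(1) by linarith
qed

section \<open>Symbolic powers\<close>

abbreviation minimal_covers :: "'v::finite set set \<Rightarrow> 'v set set" where
  "minimal_covers E \<equiv> minimal_sets (vertex_covers UNIV E)"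

lemma minimal_cover_private_edge:
  assumes "C \<in> minimal_covers E" "v \<in> C"
  shows "\<exists>e\<in>E. C \<inter> e = {v}"
proof -
  have C: "\<And>e. e \<in> E \<Longrightarrow> C \<inter> e \<noteq> {}" "\<And>C'. C' \<in> vertex_covers UNIV E \<Longrightarrow> C' \<subseteq> C \<Longrightarrow> C' = C"
    using assms(1) unfolding minimal_sets_def vertex_covers_def by auto
  have "C - {v} \<notin> vertex_covers UNIV E" using C(2)[of "C - {v}"] assms(2) by blast
  then obtain e where e: "e \<in> E" "(C - {v}) \<inter> e = {}" unfolding vertex_covers_def by auto
  then have "C \<inter> e = {v}" using C(1)[OF e(1)] by blast
  then show ?thesis using e(1) by blast
qed

text \<open>After inverting the variables outside \<open>C\<close>, the n-th power of the prime of
  \<open>C\<close> is contained in \<open>I^n\<close>. Each \<open>v\<close> in \<open>C\<close> is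
  charged to its private edge \<open>p v\<close>, with multiplicity \<open>a v\<close>; as
  \<open>p v\<close> meets \<open>C\<close> in \<open>v\<close> only, the load on \<open>C\<close>
  is exactly \<open>a\<close>.\<close>

lemma packable_up_to_complement:
  assumes "C \<in> minimal_covers E" "n \<le> cover_degree C a"
  obtains s where "\<And>v. v \<in> C \<Longrightarrow> Poly_Mapping.lookup s v = 0" "a + s \<in> packable_exponents E n"
proof -
  obtain p where p: "\<And>v. v \<in> C \<Longrightarrow> p v \<in> E \<and> C \<inter> p v = {v}"
    using minimal_cover_private_edge[OF assms(1)] by metis
  define y where "y e = (\<Sum>v\<in>{v\<in>C. p v = e}. Poly_Mapping.lookup a v)" for e
  \<comment> \<open>Outside \<open>C\<close> the load is bounded by the total multiplicity, which is
    \<open>cover_degree C a\<close>.\<close>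
  define s where "s = exponent (\<lambda>v. if v \<in> C then 0 else cover_degree C a)"
  have total: "sum y E = cover_degree C a"
    unfolding y_def cover_degree_def using p by (intro sum.group) auto
  have "(\<Sum>e\<in>{e\<in>E. v \<in> e}. y e) \<le> Poly_Mapping.lookup (a + s) v" for v
  proof (cases "v \<in> C")
    case True
    have own: "u = v" if "u \<in> C" "v \<in> p u" for u using p[OF that(1)] that(2) True by auto
    have "(\<Sum>e\<in>{e\<in>E. v \<in> e}. y e)
        = (\<Sum>e\<in>{e\<in>E. v \<in> e}. \<Sum>u\<in>{u\<in>{v}. p u = e}. Poly_Mapping.lookup a u)"
      unfolding y_def using own True
      by (intro sum.cong refl arg_cong2[where f = sum]) auto
    also have "\<dots> = (\<Sum>u\<in>{v}. Poly_Mapping.lookup a u)"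
      using p True by (intro sum.group) auto
    finally show ?thesis by (simp add: lookup_add)
  next
    case False
    have "(\<Sum>e\<in>{e\<in>E. v \<in> e}. y e) \<le> sum y E" by (intro sum_mono2) auto
    then show ?thesis using False total unfolding s_def by (simp add: lookup_add)
  qed
  moreover have "n \<le> sum y E" using total assms(2) by simp
  ultimately have "a + s \<in> packable_exponents E n"
    unfolding packable_exponents_def edge_packable_def by blast
  then show ?thesis using that[of s] unfolding s_def by simp
qed

lemma prime_variables_cover:
  fixes P :: "('v::finite, 'k::field) mpoly set"
  assumes "primeideal P mpoly_ring" "exponent_ideal (packable_exponents E 1) \<subseteq> P"
  shows "{v. variable v \<in> P} \<in> vertex_covers UNIV E"
proof -
  have "{v. variable v \<in> P} \<inter> e \<noteq> {}" if "e \<in> E" for e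
  proof -
    have "exponent (\<lambda>v. if v \<in> e then 1 else 0) \<in> packable_exponents E 1"
      unfolding packable_exponents_1 using that by auto
    then have "monomial (exponent (\<lambda>v. if v \<in> e then 1 else 0)) \<in> P" using assms(2) by auto
    from prime_monomial[OF assms(1) this] show ?thesis by (auto split: if_splits)
  qed
  then show ?thesis unfolding vertex_covers_def by simp
qed

lemma packable_subset_cover_power:
  assumes "C \<in> vertex_covers UNIV E"
  shows "exponent_ideal (packable_exponents E n) \<subseteq> cover_power C n"
  using cover_degree_packable[OF _ assms] unfolding exponent_ideal_def cover_power_def by blast

text \<open>The variables in a prime between the ideal and \<open>cover_power C 1\<close> form a
  cover inside \<open>C\<close>, hence all of \<open>C\<close> by minimality, and they generate
  \<open>cover_power C 1\<close>.\<close>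

lemma cover_power_minimal_prime:
  assumes "C \<in> minimal_covers E"
  shows "(cover_power C 1 :: ('v::finite, 'k::field) mpoly set)
    \<in> minimal_primes mpoly_ring (exponent_ideal (packable_exponents E 1))"
proof -
  have C: "C \<in> vertex_covers UNIV E" "\<And>C'. C' \<in> vertex_covers UNIV E \<Longrightarrow> C' \<subseteq> C \<Longrightarrow> C' = C"
    using assms unfolding minimal_sets_def by auto
  have "P = cover_power C 1"
    if P: "primeideal P mpoly_ring" "exponent_ideal (packable_exponents E 1) \<subseteq> P"
      "P \<subseteq> cover_power C 1" for P :: "('v, 'k) mpoly set"
  proof
    interpret primeideal P mpoly_ring by (rule P(1))
    have "{v. variable v \<in> P} \<subseteq> C" using P(3) variable_in_cover_power by blast
    then have "{v. variable v \<in> P} = C" using C(2) prime_variables_cover[OF P(1,2)] by blast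
    then show "cover_power C 1 \<subseteq> P" using is_ideal by (intro cover_power_subset) auto
  qed (rule P(3))
  then show ?thesis
    using prime_cover_power packable_subset_cover_power[OF C(1)] unfolding minimal_primes_def
    by blast
qed

text \<open>A smaller cover inside the variable set of \<open>P\<close> generates a prime between
  the ideal and \<open>P\<close>. Minimality of \<open>P\<close> makes the two primes equal, and the
  variables of a prime recover the cover.\<close>

lemma minimal_prime_variables:
  fixes P :: "('v::finite, 'k::field) mpoly set"
  assumes "P \<in> minimal_primes mpoly_ring (exponent_ideal (packable_exponents E 1))"
  shows "{v. variable v \<in> P} \<in> minimal_covers E"
proof -
  define C where "C = {v. variable v \<in> P}"
  have P: "primeideal P mpoly_ring" "exponent_ideal (packable_exponents E 1) \<subseteq> P"
    "\<And>P'. primeideal P' mpoly_ring \<Longrightarrow> exponent_ideal (packable_exponents E 1) \<subseteq> P' \<Longrightarrow>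
      P' \<subseteq> P \<Longrightarrow> P' = P"
    using assms unfolding minimal_primes_def by auto
  interpret primeideal P mpoly_ring by (rule P(1))
  have "C' = C" if C': "C' \<in> vertex_covers UNIV E" "C' \<subseteq> C" for C'
  proof -
    have "cover_power C' 1 \<subseteq> P"
      using C'(2) is_ideal unfolding C_def by (intro cover_power_subset) auto
    then have "cover_power C' 1 = P"
      using P(3)[OF prime_cover_power packable_subset_cover_power[OF C'(1)]] by blast
    then show ?thesis unfolding C_def using variable_in_cover_power by blast
  qed
  then show ?thesis
    using prime_variables_cover[OF P(1,2)] unfolding minimal_sets_def C_def by blast
qed

lemma primary_mpoly_ringD:
  fixes Q :: "('v::finite, 'k::field) mpoly set"
  assumes "primary_ideal mpoly_ring Q" "f * g \<in> Q"
  shows "f \<in> Q \<or> g \<in> ideal_radical mpoly_ring Q"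
  using assms(1)[unfolded primary_ideal_def, THEN conjunct2, THEN conjunct2, rule_format, of f g]
    assms(2)
  by (simp add: ideal_radical_def)

text \<open>Let \<open>Q\<close> be any component over a minimal prime \<open>P\<close>. The
  monomial of \<open>s\<close> has only variables outside \<open>P\<close>, so it is not in
  \<open>P\<close>, and its product with the monomial of \<open>a\<close> is in \<open>I^n\<close>
  and so in \<open>Q\<close>. Since \<open>Q\<close> is primary, the factor outside its radical
  cancels.\<close>

lemma symbolic_power_monomial:
  fixes I :: "('v::finite, 'k::field) mpoly set"
  assumes "I = exponent_ideal (packable_exponents E 1)"
    and "ideal_power mpoly_ring I n = exponent_ideal (packable_exponents E n)"
    and "\<And>C. C \<in> minimal_covers E \<Longrightarrow> n \<le> cover_degree C a"
  shows "monomial a \<in> symbolic_power mpoly_ring I n"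
proof -
  have "monomial a \<in> Q"
    if "minimal_primary_decomposition mpoly_ring \<Q> (ideal_power mpoly_ring I n)" "Q \<in> \<Q>"
      "ideal_radical mpoly_ring Q \<in> minimal_primes mpoly_ring I"
    for \<Q> and Q :: "('v, 'k) mpoly set"
  proof -
    define P where "P = ideal_radical mpoly_ring Q"
    define C where "C = {v. variable v \<in> P}"
    have C: "C \<in> minimal_covers E"
      using minimal_prime_variables that(3) unfolding C_def P_def assms(1) by blast
    then obtain s where s: "\<And>v. v \<in> C \<Longrightarrow> Poly_Mapping.lookup s v = 0"
        "a + s \<in> packable_exponents E n"
      using packable_up_to_complement[OF C assms(3)[OF C]] by blast
    have "ideal_power mpoly_ring I n \<subseteq> Q" and prim: "primary_ideal mpoly_ring Q"
      using that(1,2) unfolding minimal_primary_decomposition_def by auto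
    moreover have "monomial (a + s) \<in> ideal_power mpoly_ring I n"
      unfolding assms(2) using s(2) by simp
    ultimately have "monomial a * monomial s \<in> Q" unfolding monomial_add by blast
    then have "monomial a \<in> Q \<or> monomial s \<in> P"
      unfolding P_def by (rule primary_mpoly_ringD[OF prim])
    moreover have "monomial s \<notin> P"
    proof
      assume "monomial s \<in> P"
      moreover have "primeideal P mpoly_ring"
        using that(3) unfolding P_def minimal_primes_def by blast
      ultimately obtain v where "Poly_Mapping.lookup s v \<noteq> 0" "variable v \<in> P"
        using prime_monomial by metis
      then show False using s(1)[of v] unfolding C_def by simp
    qed
    ultimately show ?thesis by blast
  qed
  then show ?thesis unfolding symbolic_power_def by auto
qed

lemma ideal_power_subset_symbolic_power:
  fixes I :: "('v::finite, 'k::field) mpoly set"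
  shows "ideal_power mpoly_ring I n \<subseteq> symbolic_power mpoly_ring I n"
  unfolding symbolic_power_def minimal_primary_decomposition_def by auto

lemma cover_powers_primary_decomposition:
  assumes "1 \<le> n"
  shows "minimal_primary_decomposition mpoly_ring ((\<lambda>C. cover_power C n) ` minimal_covers E)
    (\<Inter>C\<in>minimal_covers E. cover_power C n :: ('v::finite, 'k::field) mpoly set)"
  unfolding minimal_primary_decomposition_def
proof (intro conjI ballI)
  show "inj_on (ideal_radical mpoly_ring)
      ((\<lambda>C. cover_power C n :: ('v, 'k) mpoly set) ` minimal_covers E)"
  proof (rule inj_onI, elim imageE)
    fix Q Q' :: "('v, 'k) mpoly set" and C C'
    assume Q: "Q = cover_power C n" "Q' = cover_power C' n"
      and eq: "ideal_radical mpoly_ring Q = ideal_radical mpoly_ring Q'"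
    have "cover_power C 1 = (cover_power C' 1 :: ('v, 'k) mpoly set)"
      using eq unfolding Q radical_cover_power[OF assms] .
    then have "v \<in> C \<longleftrightarrow> v \<in> C'" for v using variable_in_cover_power by metis
    then have "C = C'" by blast
    then show "Q = Q'" unfolding Q by simp
  qed
next
  fix Q :: "('v, 'k) mpoly set"
  assume "Q \<in> (\<lambda>C. cover_power C n) ` minimal_covers E"
  then obtain C where C: "C \<in> minimal_covers E" "Q = cover_power C n" by blast
  \<comment> \<open>This monomial shows that \<open>C\<close> is irredundant: it has degree 0 on
    \<open>C\<close>, and degree at least \<open>n\<close> on every other minimal cover, since that
    cover has a vertex outside \<open>C\<close>.\<close>
  define a where "a = exponent (\<lambda>v. if v \<in> C then 0 else n)"
  have "cover_degree C a = 0" unfolding cover_degree_def a_def by simp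
  then have notin: "monomial a \<notin> Q" unfolding C(2) monomial_in_cover_power using assms by simp
  have "monomial a \<in> Q'" if Q': "Q' \<in> (\<lambda>C. cover_power C n) ` minimal_covers E - {Q}" for Q'
  proof -
    obtain C' where C': "C' \<in> minimal_covers E" "Q' = cover_power C' n" using Q' by blast
    have "C' \<noteq> C" using Q' unfolding C(2) C'(2) by auto
    then have "\<not> C' \<subseteq> C" using C(1) C'(1) unfolding minimal_sets_def by blast
    then obtain v where v: "v \<in> C'" "v \<notin> C" by blast
    then have "n \<le> cover_degree C' a"
      using member_le_sum[of v C' "Poly_Mapping.lookup a"] unfolding cover_degree_def
      by (simp add: a_def)
    then show ?thesis unfolding C'(2) monomial_in_cover_power .
  qed
  then have "monomial a \<in> carrier mpoly_ring \<inter>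
      \<Inter>((\<lambda>C. cover_power C n) ` minimal_covers E - {Q})" by simp
  then show "\<not> carrier mpoly_ring \<inter> \<Inter>((\<lambda>C. cover_power C n) ` minimal_covers E - {Q}) \<subseteq> Q"
    using notin by blast
qed (use primary_cover_power[OF assms] in auto)

lemma symbolic_power_subset_cover_power:
  fixes I :: "('v::finite, 'k::field) mpoly set"
  assumes "1 \<le> n" "I = exponent_ideal (packable_exponents E 1)"
    and "ideal_power mpoly_ring I n = (\<Inter>C\<in>minimal_covers E. cover_power C n)"
    and "C \<in> minimal_covers E"
  shows "symbolic_power mpoly_ring I n \<subseteq> cover_power C n"
proof -
  have "minimal_primary_decomposition mpoly_ring ((\<lambda>C. cover_power C n) ` minimal_covers E)
      (ideal_power mpoly_ring I n)"
    unfolding assms(3) by (rule cover_powers_primary_decomposition[OF assms(1)])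
  moreover have "ideal_radical mpoly_ring (cover_power C n) \<in> minimal_primes mpoly_ring I"
    unfolding radical_cover_power[OF assms(1)] assms(2) by (rule cover_power_minimal_prime[OF assms(4)])
  ultimately show ?thesis using assms(4) unfolding symbolic_power_def by blast
qed

lemma powers_equal_iff_cover_packing:
  fixes I :: "('v::finite, 'k::field) mpoly set"
  assumes "1 \<le> n" "I = exponent_ideal (packable_exponents E 1)"
    and "ideal_power mpoly_ring I n = exponent_ideal (packable_exponents E n)"
  shows "ideal_power mpoly_ring I n = symbolic_power mpoly_ring I n \<longleftrightarrow> cover_packing UNIV E n"
proof
  assume eq: "ideal_power mpoly_ring I n = symbolic_power mpoly_ring I n"
  show "cover_packing UNIV E n"
    unfolding cover_packing_def
  proof (intro allI impI)
    fix a :: "'v \<Rightarrow> nat"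
    assume a: "\<forall>C\<in>vertex_covers UNIV E. n \<le> sum a C"
    have "monomial (exponent a) \<in> symbolic_power mpoly_ring I n"
      using a minimal_sets_subset
      by (intro symbolic_power_monomial[OF assms(2,3)]) (auto simp: cover_degree_def)
    then show "edge_packable UNIV E n a"
      unfolding eq[symmetric] assms(3) monomial_in_exponent_ideal packable_exponents_def by simp
  qed
next
  assume pack: "cover_packing UNIV E n"
  have "a \<in> packable_exponents E n" if "\<And>C. C \<in> minimal_covers E \<Longrightarrow> n \<le> cover_degree C a" for a
  proof -
    have "n \<le> sum (Poly_Mapping.lookup a) C" if C: "C \<in> vertex_covers UNIV E" for C
    proof -
      obtain C' where "C' \<in> minimal_covers E" "C' \<subseteq> C"
        using exists_minimal_subset[OF finite C] by blast
      moreover from this have "cover_degree C' a \<le> sum (Poly_Mapping.lookup a) C"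
        unfolding cover_degree_def by (intro sum_mono2) auto
      ultimately show ?thesis
        using \<open>\<And>C. C \<in> minimal_covers E \<Longrightarrow> n \<le> cover_degree C a\<close> le_trans by blast
    qed
    then show ?thesis using pack unfolding cover_packing_def packable_exponents_def by blast
  qed
  then have "(\<Inter>C\<in>minimal_covers E. cover_power C n) \<subseteq> ideal_power mpoly_ring I n"
    unfolding assms(3) cover_power_def exponent_ideal_def by blast
  moreover have "ideal_power mpoly_ring I n \<subseteq> (\<Inter>C\<in>minimal_covers E. cover_power C n)"
    unfolding assms(3) using packable_subset_cover_power minimal_sets_subset by blast
  \<comment> \<open>This equality turns the cover powers into the components of a decomposition of
    \<open>I^n\<close>, so that \<open>symbolic_power\<close> is contained in each of them.\<close>
  ultimately have "ideal_power mpoly_ring I n = (\<Inter>C\<in>minimal_covers E. cover_power C n)"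
    by (rule equalityI[rotated])
  then have "symbolic_power mpoly_ring I n \<subseteq> ideal_power mpoly_ring I n"
    using symbolic_power_subset_cover_power[OF assms(1,2)] by blast
  then show "ideal_power mpoly_ring I n = symbolic_power mpoly_ring I n"
    using ideal_power_subset_symbolic_power by blast
qed

section \<open>Transfer to natural numbers as vertices, and conclusion\<close>

lemma cover_packing_image:
  fixes h :: "'v::finite \<Rightarrow> 'w"
  assumes "inj h" "cover_packing UNIV E n"
  shows "cover_packing (range h) ((`) h ` E) n"
  unfolding cover_packing_def
proof (intro allI impI)
  fix a :: "'w \<Rightarrow> nat"
  assume a: "\<forall>C\<in>vertex_covers (range h) ((`) h ` E). n \<le> sum a C"
  have "n \<le> sum (a \<circ> h) C" if "C \<in> vertex_covers UNIV E" for C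
  proof -
    have "h ` C \<in> vertex_covers (range h) ((`) h ` E)"
      using that unfolding vertex_covers_def by (auto simp flip: image_Int[OF assms(1)])
    then have "n \<le> sum a (h ` C)" using a by blast
    then show ?thesis using sum.reindex[OF inj_on_subset[OF assms(1) subset_UNIV], of a C] by simp
  qed
  then have "edge_packable UNIV E n (a \<circ> h)" using assms(2) unfolding cover_packing_def by blast
  then show "edge_packable (range h) ((`) h ` E) n a"
    by (rule edge_packable_map[where g = "(`) h" and k = "inv_into UNIV h"])
      (use assms(1) in \<open>auto simp: inj_image_mem_iff\<close>)
qed

theorem mainTheorem5:
  fixes I :: "(('v::finite \<Rightarrow>\<^sub>0 nat) \<Rightarrow>\<^sub>0 'k::field) set"
  assumes conforti_cornuejols:
      "\<And>(V :: nat set) (E :: nat set set).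
         simple_hypergraph V E \<Longrightarrow> packing_property V E \<Longrightarrow> mfmc_property V E"
    and "squarefree_monomial_ideal I"
    and "\<forall>n::nat. 1 \<le> n \<and> int n \<le> \<lceil>(real (card (UNIV :: 'v set)) + 1) / 2\<rceil> \<longrightarrow>
           ideal_power mpoly_ring I n = symbolic_power mpoly_ring I n"
  shows "\<forall>n::nat. 1 \<le> n \<longrightarrow> ideal_power mpoly_ring I n = symbolic_power mpoly_ring I n"
proof -
  obtain E :: "'v set set" where antichain: "\<And>e f. e \<in> E \<Longrightarrow> f \<in> E \<Longrightarrow> e \<subseteq> f \<Longrightarrow> e = f"
    and power: "\<And>n. ideal_power mpoly_ring I n = exponent_ideal (packable_exponents E n)"
    and I: "I = exponent_ideal (packable_exponents E 1)"
    using squarefree_ideal_powers[OF assms(2)] by blast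
  note iff = powers_equal_iff_cover_packing[OF _ I power]
  have small: "cover_packing UNIV E n" if "2 * n \<le> card (UNIV :: 'v set) + 2" for n
  proof (cases "n = 0")
    case True
    then show ?thesis
      unfolding cover_packing_def edge_packable_def by (auto intro: exI[of _ "\<lambda>e. 0"])
  next
    case False
    \<comment> \<open>The ceiling bound unfolds to \<open>n - 1 < (d + 1) / 2\<close>, that is,
      \<open>2 * n < d + 3\<close>.\<close>
    have "2 * real n \<le> real (card (UNIV :: 'v set)) + 2" using that by linarith
    then have "int n \<le> \<lceil>(real (card (UNIV :: 'v set)) + 1) / 2\<rceil>" by (simp add: le_ceiling_iff)
    then show ?thesis using assms(3) iff[of n] False by simp
  qed
  have "cover_packing UNIV E n" for n
  proof (cases "{} \<in> E")
    case True
    \<comment> \<open>Here \<open>I\<close> is the whole ring and \<open>E\<close> is not a simple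
      hypergraph, so the conjecture does not apply. But \<open>n\<close> copies of the empty edge
      load no vertex.\<close>
    define y where "y e = (if e = {} then n else 0)" for e :: "'v set"
    have "n \<le> sum y E" unfolding y_def using True by simp
    moreover have "(\<Sum>e\<in>{e\<in>E. v \<in> e}. y e) = 0" for v
      unfolding y_def by (intro sum.neutral) auto
    ultimately show ?thesis unfolding cover_packing_def edge_packable_def by (metis le0)
  next
    case False
    \<comment> \<open>The conjecture is assumed for hypergraphs on natural numbers, so
      \<open>E\<close> is copied there along an injection.\<close>
    obtain h :: "'v \<Rightarrow> nat" where h: "inj h"
      using finite_imp_inj_to_nat_seg[OF finite[of "UNIV :: 'v set"]] by blast
    have sub: "(`) h ` E \<subseteq> Pow (range h)" by blast
    have "h ` e = h ` f" if "e \<in> E" "f \<in> E" "h ` e \<subseteq> h ` f" for e f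
      using antichain[of e f] that by (simp add: inj_image_subset_iff[OF h])
    then have "\<forall>e\<in>(`) h ` E. \<forall>f\<in>(`) h ` E. e \<subseteq> f \<longrightarrow> e = f" by auto
    moreover have "{} \<notin> (`) h ` E" using False by auto
    ultimately have "simple_hypergraph (range h) ((`) h ` E)"
      unfolding simple_hypergraph_def using sub by simp
    moreover have "packing_property (range h) ((`) h ` E)"
      using small cover_packing_image[OF h] by (intro packing_propertyI sub) (auto simp: card_image h)
    ultimately show ?thesis by (intro mfmc_imp_cover_packing[OF h] conforti_cornuejols)
  qed
  then show ?thesis using iff by blast
qed

end
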